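(* Let $\mathbf{k}$ be a commutative unitary ring. The $\mathbf{k}$-submodule $\overline{\mathrm{LWCQSym}}$ of $\mathbf{k}[[x_0,x_1,x_2,\ldots]]$ spanned by the $\overline{M}_\alpha$, $\alpha\in\mathbb{N}^k\times\mathbb{P}$, $k\geq 0$, is closed under multiplication, the $\mathbf{k}$-linear operator $P_Q:\overline{\mathrm{LWCQSym}}\to\overline{\mathrm{LWCQSym}}$ defined by $P_Q(\overline{M}_\alpha)=\overline{M}_{(0,\alpha)}$ is a Rota–Baxter operator of weight $1$, and $(\overline{\mathrm{LWCQSym}},P_Q)$ is (isomorphic to) the free commutative nonunitary Rota–Baxter algebra of weight $1$ on one generator.
   Context: $x_0,x_1,\ldots$ are commuting variables. For a finite sequence $\alpha'=(\alpha_1,\ldots,\alpha_k)$ of nonnegative integers, $M_{\alpha'}=\sum_{1\leq n_1<\cdots<n_k}x_{n_1}^{\alpha_1}\cdots x_{n_k}^{\alpha_k}$ with $M_{()}=1$. For $\alpha=(\alpha_0,\alpha_1,\ldots,\alpha_k)\in\mathbb{N}^k\times\mathbb{P}$, $\overline{M}_\alpha=x_0^{\alpha_0}M_{(\alpha_1,\ldots,\alpha_k)}$ (so $\overline{M}_{(0,\alpha)}=M_\alpha$). A Rota–Baxter operator of weight $1$ on a (possibly nonunitary) commutative $\mathbf{k}$-algebra $R$ is a $\mathbf{k}$-linear map $P:R\to R$ with $P(x)P(y)=P(xP(y))+P(P(x)y)+P(xy)$ for all $x,y\in R$. A free commutative nonunitary Rota–Baxter algebra of weight 1 on one generator $x$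 is a commutative nonunitary Rota–Baxter algebra $(F,P_F)$ of weight 1 with an element $x\in F$ such that for every commutative nonunitary Rota–Baxter algebra $(R,P)$ of weight 1 and every $r\in R$ there is a unique Rota–Baxter algebra homomorphism $F\to R$ (algebra homomorphism commuting with the operators) sending $x$ to $r$. *)

theory Defs
  imports "HOL-Library.FuncSet" "HOL-Library.Multiset" "HOL-Algebra.Module"
begin

section \<open>Nonunitary commutative algebras and Rota--Baxter operators of weight 1\<close>

text \<open>Algebras are carried by the record type of \<^locale>\<open>module\<close>; for a nonunitary algebra its
  field \<^const>\<open>one\<close> is junk and is never mentioned.\<close>

locale nonunital_comm_algebra = module k A for k (structure) and A (structure) +
  assumes mult_closed:
      "\<lbrakk>x \<in> carrier A; y \<in> carrier A\<rbrakk> \<Longrightarrow> x \<otimes>\<^bsub>A\<^esub> y \<in> carrier A"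
    and mult_assoc:
      "\<lbrakk>x \<in> carrier A; y \<in> carrier A; z \<in> carrier A\<rbrakk> \<Longrightarrow>
        (x \<otimes>\<^bsub>A\<^esub> y) \<otimes>\<^bsub>A\<^esub> z = x \<otimes>\<^bsub>A\<^esub> (y \<otimes>\<^bsub>A\<^esub> z)"
    and mult_comm:
      "\<lbrakk>x \<in> carrier A; y \<in> carrier A\<rbrakk> \<Longrightarrow> x \<otimes>\<^bsub>A\<^esub> y = y \<otimes>\<^bsub>A\<^esub> x"
    and mult_add_distr:
      "\<lbrakk>x \<in> carrier A; y \<in> carrier A; z \<in> carrier A\<rbrakk> \<Longrightarrow>
        (x \<oplus>\<^bsub>A\<^esub> y) \<otimes>\<^bsub>A\<^esub> z = (x \<otimes>\<^bsub>A\<^esub> z) \<oplus>\<^bsub>A\<^esub> (y \<otimes>\<^bsub>A\<^esub> z)"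
    and mult_smult:
      "\<lbrakk>c \<in> carrier k; x \<in> carrier A; y \<in> carrier A\<rbrakk> \<Longrightarrow>
        (c \<odot>\<^bsub>A\<^esub> x) \<otimes>\<^bsub>A\<^esub> y = c \<odot>\<^bsub>A\<^esub> (x \<otimes>\<^bsub>A\<^esub> y)"

definition linear_map ::
  "('k, 'm) ring_scheme \<Rightarrow> ('k, 'a, 'x) module_scheme \<Rightarrow> ('k, 'b, 'y) module_scheme
    \<Rightarrow> ('a \<Rightarrow> 'b) \<Rightarrow> bool" where
  "linear_map k A B f \<longleftrightarrow>
     f \<in> carrier A \<rightarrow> carrier B \<and>
     (\<forall>x\<in>carrier A. \<forall>y\<in>carrier A. f (x \<oplus>\<^bsub>A\<^esub> y) = f x \<oplus>\<^bsub>B\<^esub> f y) \<and>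
     (\<forall>c\<in>carrier k. \<forall>x\<in>carrier A. f (c \<odot>\<^bsub>A\<^esub> x) = c \<odot>\<^bsub>B\<^esub> f x)"

definition rota_baxter_operator ::
  "('k, 'm) ring_scheme \<Rightarrow> ('k, 'a, 'x) module_scheme \<Rightarrow> ('a \<Rightarrow> 'a) \<Rightarrow> bool" where
  "rota_baxter_operator k A P \<longleftrightarrow>
     linear_map k A A P \<and>
     (\<forall>x\<in>carrier A. \<forall>y\<in>carrier A.
        P x \<otimes>\<^bsub>A\<^esub> P y = P (x \<otimes>\<^bsub>A\<^esub> P y) \<oplus>\<^bsub>A\<^esub> P (P x \<otimes>\<^bsub>A\<^esub> y) \<oplus>\<^bsub>A\<^esub> P (x \<otimes>\<^bsub>A\<^esub> y))"

definition comm_rota_baxter_algebra ::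
  "('k, 'm) ring_scheme \<Rightarrow> ('k, 'a, 'x) module_scheme \<Rightarrow> ('a \<Rightarrow> 'a) \<Rightarrow> bool" where
  "comm_rota_baxter_algebra k A P \<longleftrightarrow>
     nonunital_comm_algebra k A \<and> rota_baxter_operator k A P"

definition rota_baxter_hom ::
  "('k, 'm) ring_scheme \<Rightarrow> ('k, 'a, 'x) module_scheme \<Rightarrow> ('a \<Rightarrow> 'a)
    \<Rightarrow> ('k, 'b, 'y) module_scheme \<Rightarrow> ('b \<Rightarrow> 'b) \<Rightarrow> ('a \<Rightarrow> 'b) \<Rightarrow> bool" where
  "rota_baxter_hom k A P B Q f \<longleftrightarrow>
     linear_map k A B f \<and>
     (\<forall>x\<in>carrier A. \<forall>y\<in>carrier A. f (x \<otimes>\<^bsub>A\<^esub> y) = f x \<otimes>\<^bsub>B\<^esub> f y) \<and>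
     (\<forall>x\<in>carrier A. f (P x) = Q (f x))"

text \<open>The universal property of the pair \<open>(F, PF)\<close> with generator \<open>x\<close>, tested against all algebras
  whose elements have type \<open>'r\<close>.  A theorem that leaves \<open>'r\<close> free asserts it for all of them.
  A homomorphism matters only on the carrier, whence \<^const>\<open>extensional\<close>.\<close>

definition free_comm_rota_baxter_algebra ::
  "'r itself \<Rightarrow> ('k, 'm) ring_scheme \<Rightarrow> ('k, 'a, 'x) module_scheme \<Rightarrow> ('a \<Rightarrow> 'a) \<Rightarrow> 'a \<Rightarrow> bool" where
  "free_comm_rota_baxter_algebra (_ :: 'r itself) k F PF x \<longleftrightarrow>
     comm_rota_baxter_algebra k F PF \<and> x \<in> carrier F \<and>
     (\<forall>(R :: ('k, 'r) module) P r.
        comm_rota_baxter_algebra k R P \<and> r \<in> carrier R \<longrightarrow>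
        (\<exists>!h. h \<in> extensional (carrier F) \<and> rota_baxter_hom k F PF R P h \<and> h x = r))"

section \<open>Formal power series in $x_0, x_1, x_2, \ldots$\<close>

text \<open>Monomials are finite multisets of variable indices (as in \<open>HOL-Algebra.Indexed_Polynomials\<close>),
  and a power series maps each monomial to its coefficient.\<close>

definition power_series ::
  "('k, 'm) ring_scheme \<Rightarrow> ('k, nat multiset \<Rightarrow> 'k) module" where
  "power_series k =
     \<lparr>carrier = {f. \<forall>m. f m \<in> carrier k},
      mult = (\<lambda>f g m. \<Oplus>\<^bsub>k\<^esub>p \<in> {p. fst p + snd p = m}. f (fst p) \<otimes>\<^bsub>k\<^esub> g (snd p)),
      one = (\<lambda>m. if m = {#} then \<one>\<^bsub>k\<^esub> else \<zero>\<^bsub>k\<^esub>),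
      zero = (\<lambda>m. \<zero>\<^bsub>k\<^esub>),
      add = (\<lambda>f g m. f m \<oplus>\<^bsub>k\<^esub> g m),
      smult = (\<lambda>c f m. c \<otimes>\<^bsub>k\<^esub> f m)\<rparr>"

definition var :: "('k, 'm) ring_scheme \<Rightarrow> nat \<Rightarrow> nat multiset \<Rightarrow> 'k" where
  "var k n = (\<lambda>m. if m = {#n#} then \<one>\<^bsub>k\<^esub> else \<zero>\<^bsub>k\<^esub>)"

text \<open>The sum of a family of power series that is locally finite, i.e. in which every monomial has
  a nonzero coefficient in only finitely many members.\<close>

definition series_sum ::
  "('k, 'm) ring_scheme \<Rightarrow> ('i \<Rightarrow> nat multiset \<Rightarrow> 'k) \<Rightarrow> 'i set \<Rightarrow> nat multiset \<Rightarrow> 'k" where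
  "series_sum k f I = (\<lambda>m. \<Oplus>\<^bsub>k\<^esub>i \<in> {i \<in> I. f i m \<noteq> \<zero>\<^bsub>k\<^esub>}. f i m)"

text \<open>$x_{n_1}^{\alpha_1} \cdots x_{n_k}^{\alpha_k}$\<close>

definition monomial_series ::
  "('k, 'm) ring_scheme \<Rightarrow> nat list \<Rightarrow> nat list \<Rightarrow> nat multiset \<Rightarrow> 'k" where
  "monomial_series k \<alpha> ns =
     foldr (\<lambda>(n, a) f. (var k n [^]\<^bsub>power_series k\<^esub> a) \<otimes>\<^bsub>power_series k\<^esub> f)
       (zip ns \<alpha>) \<one>\<^bsub>power_series k\<^esub>"

section \<open>Left weak composition quasi-symmetric functions\<close>

text \<open>The family summed in \<open>M_qsym\<close> is locally finite if \<open>\<alpha>\<close> is empty or its last entry is positive,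
  which holds wherever it is used below; for other \<open>\<alpha>\<close> the formal sum does not exist and the
  value is junk.\<close>

definition M_qsym :: "('k, 'm) ring_scheme \<Rightarrow> nat list \<Rightarrow> nat multiset \<Rightarrow> 'k" where
  "M_qsym k \<alpha> =
     series_sum k (monomial_series k \<alpha>)
       {ns. length ns = length \<alpha> \<and> sorted_wrt (<) ns \<and> (\<forall>n\<in>set ns. 1 \<le> n)}"

text \<open>\<open>tl \<alpha>\<close> is $(\alpha_1, \ldots, \alpha_k)$ for \<open>\<alpha>\<close> $= (\alpha_0, \alpha_1, \ldots, \alpha_k)$.\<close>

definition M_bar :: "('k, 'm) ring_scheme \<Rightarrow> nat list \<Rightarrow> nat multiset \<Rightarrow> 'k" where
  "M_bar k \<alpha> = (var k 0 [^]\<^bsub>power_series k\<^esub> hd \<alpha>) \<otimes>\<^bsub>power_series k\<^esub> M_qsym k (tl \<alpha>)"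

text \<open>The union of the sets $\mathbb{N}^k \times \mathbb{P}$ over all $k \ge 0$.\<close>

definition left_weak_compositions :: "nat list set" where
  "left_weak_compositions = {\<alpha>. \<alpha> \<noteq> [] \<and> last \<alpha> > 0}"

definition module_span ::
  "('k, 'm) ring_scheme \<Rightarrow> ('k, 'a, 'x) module_scheme \<Rightarrow> 'a set \<Rightarrow> 'a set" where
  "module_span k A S = \<Inter>{H. submodule H k A \<and> S \<subseteq> H}"

definition LWCQSym_bar :: "('k, 'm) ring_scheme \<Rightarrow> ('k, nat multiset \<Rightarrow> 'k) module" where
  "LWCQSym_bar k =
     (power_series k)
       \<lparr>carrier := module_span k (power_series k) (M_bar k ` left_weak_compositions)\<rparr>"

definition is_P_Q ::
  "('k, 'm) ring_scheme \<Rightarrow> ((nat multiset \<Rightarrow> 'k) \<Rightarrow> (nat multiset \<Rightarrow> 'k)) \<Rightarrow> bool" where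
  "is_P_Q k P \<longleftrightarrow>
     P \<in> extensional (carrier (LWCQSym_bar k)) \<and>
     linear_map k (LWCQSym_bar k) (LWCQSym_bar k) P \<and>
     (\<forall>\<alpha>\<in>left_weak_compositions. P (M_bar k \<alpha>) = M_bar k (0 # \<alpha>))"

definition P_Q ::
  "('k, 'm) ring_scheme \<Rightarrow> (nat multiset \<Rightarrow> 'k) \<Rightarrow> (nat multiset \<Rightarrow> 'k)" where
  "P_Q k = (THE P. is_P_Q k P)"

end

theory Submission
  imports Defs
begin

text \<open>Let \<open>S\<close> be the shift $x_i \mapsto x_{i+1}$.  Since \<open>S\<close> is an algebra endomorphism,
  $P = \sum_{n \ge 1} S^n$ is a Rota--Baxter operator of weight 1 on the power series without constant
  term: split the double sum for \<open>P(f) P(g)\<close> along its diagonal.  One has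
  $\overline{M}_{(a)} = x_0^a$ and $\overline{M}_{(a, \alpha)} = x_0^a P(\overline{M}_\alpha)$, so the
  $\overline{M}_\alpha$ are the words in the generator $x_0$, and the Rota--Baxter identity, applied
  recursively, expands a product of two words into words.  The same recursion computes products of words
  in any commutative Rota--Baxter algebra, so sending words to words is a homomorphism as soon as it is
  well defined.  For this the words are linearly independent: $f = P(g)$ determines \<open>g\<close> by
  $S(g) = f - S(f)$, which makes it possible to read off coordinates recursively and gives a dual basis.\<close>

section \<open>The algebra of power series\<close>

text \<open>The circularity to avoid: products of words are expanded by the Rota-Baxter identity,
  while the span is known to be a Rota-Baxter algebra only once those products lie in it. The
  expansion is therefore carried out in the larger ideal of all series with zero constant term, and
  stability of the span is read off from it. No infinite sum of shifts is formed: lowering the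
  indices of a monomial gives a recursion for its coefficient, and the diagonal splitting turns into
  the equation y = S(h + y). The constant term is the delicate point, because S fixes it: the sum of
  its iterates has no meaning, and the equation leaves it undetermined. The operator on the span is
  a restriction of P and thus well defined without any basis; independence of the words enters only
  when a homomorphism out of the span is constructed. Since k is an arbitrary commutative ring,
  possibly zero, independence is expressed by linear functionals with values 1 and 0 on the words,
  obtained from coefficients by subtraction alone.\<close>

lemma finite_splittings: "finite {p :: 'i multiset \<times> 'i multiset. fst p + snd p = m}"
proof (induction m)
  case empty
  then show ?case
    by (rule finite_subset[of _ "{({#}, {#})}"]) auto
next
  case (add x m)
  let ?S = "{p. fst p + snd p = m}"
  have "{p. fst p + snd p = add_mset x m}
      \<subseteq> (\<lambda>p. (add_mset x (fst p), snd p)) ` ?S \<union> (\<lambda>p. (fst p, add_mset x (snd p))) ` ?S"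
  proof
    fix p assume "p \<in> {p. fst p + snd p = add_mset x m}"
    then have p: "fst p + snd p = add_mset x m" by simp
    then have "x \<in># fst p \<or> x \<in># snd p"
      by (metis union_iff union_single_eq_member)
    then show "p \<in> (\<lambda>p. (add_mset x (fst p), snd p)) ` ?S \<union> (\<lambda>p. (fst p, add_mset x (snd p))) ` ?S"
    proof
      assume "x \<in># fst p"
      then obtain a where "fst p = add_mset x a" by (metis multi_member_split)
      with p have "p = (\<lambda>p. (add_mset x (fst p), snd p)) (a, snd p)" "(a, snd p) \<in> ?S"
        by (auto simp: prod_eq_iff)
      then show ?thesis by blast
    next
      assume "x \<in># snd p"
      then obtain a where "snd p = add_mset x a" by (metis multi_member_split)
      with p have "p = (\<lambda>p. (fst p, add_mset x (snd p))) (fst p, a)" "(fst p, a) \<in> ?S"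
        by (auto simp: prod_eq_iff)
      then show ?thesis by blast
    qed
  qed
  then show ?case
    using add.IH by (meson finite_Un finite_imageI finite_subset)
qed

text \<open>Flattens both bracketings of a triple convolution product into sums over pairs of
  splittings, where reindexing can compare them.\<close>

lemma (in abelian_monoid) finsum_Sigma:
  assumes "finite A" "\<And>x. x \<in> A \<Longrightarrow> finite (B x)"
    and f: "\<And>x y. x \<in> A \<Longrightarrow> y \<in> B x \<Longrightarrow> f (x, y) \<in> carrier G"
  shows "(\<Oplus>x\<in>A. \<Oplus>y\<in>B x. f (x, y)) = finsum G f (Sigma A B)"
proof -
  have "finsum G f (Sigma A B) = finsum G f (\<Union>x\<in>A. Pair x ` B x)"
    by (rule arg_cong[where f = "finsum G f"]) auto
  also have "\<dots> = (\<Oplus>x\<in>A. finsum G f (Pair x ` B x))"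
    using assms by (intro add.finprod_UN_disjoint) (auto simp: pairwise_def disjnt_def)
  also have "\<dots> = (\<Oplus>x\<in>A. \<Oplus>y\<in>B x. f (x, y))"
  proof (rule finsum_cong')
    show "(\<lambda>x. \<Oplus>y\<in>B x. f (x, y)) \<in> A \<rightarrow> carrier G"
      using f by (auto intro!: finsum_closed)
    show "finsum G f (Pair x ` B x) = (\<Oplus>y\<in>B x. f (x, y))" if "x \<in> A" for x
      using f that by (subst finsum_reindex) (auto simp: inj_on_def)
  qed simp
  finally show ?thesis by simp
qed

lemma power_series_simps:
  "f \<in> carrier (power_series k) \<longleftrightarrow> (\<forall>m. f m \<in> carrier k)"
  "(f \<oplus>\<^bsub>power_series k\<^esub> g) m = f m \<oplus>\<^bsub>k\<^esub> g m"
  "\<zero>\<^bsub>power_series k\<^esub> m = \<zero>\<^bsub>k\<^esub>"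
  "(c \<odot>\<^bsub>power_series k\<^esub> f) m = c \<otimes>\<^bsub>k\<^esub> f m"
  "\<one>\<^bsub>power_series k\<^esub> m = (if m = {#} then \<one>\<^bsub>k\<^esub> else \<zero>\<^bsub>k\<^esub>)"
  by (simp_all add: power_series_def)

lemma power_series_mult:
  "(f \<otimes>\<^bsub>power_series k\<^esub> g) m =
     (\<Oplus>\<^bsub>k\<^esub>p \<in> {p. fst p + snd p = m}. f (fst p) \<otimes>\<^bsub>k\<^esub> g (snd p))"
  by (simp add: power_series_def)

text \<open>The unit, the variables and \<open>monomial_series\<close> all have this form, so their
  products become multiset addition, and multiplication by one of them translates exponents.\<close>

definition monomial :: "('k, 'm) ring_scheme \<Rightarrow> nat multiset \<Rightarrow> nat multiset \<Rightarrow> 'k" where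
  "monomial k u = (\<lambda>m. if m = u then \<one>\<^bsub>k\<^esub> else \<zero>\<^bsub>k\<^esub>)"

context cring
begin

lemma power_series_mult_closed:
  assumes "f \<in> carrier (power_series R)" "g \<in> carrier (power_series R)"
  shows "f \<otimes>\<^bsub>power_series R\<^esub> g \<in> carrier (power_series R)"
  using assms by (auto simp: power_series_simps power_series_mult intro!: finsum_closed)

lemma power_series_mult_comm:
  assumes "f \<in> carrier (power_series R)" "g \<in> carrier (power_series R)"
  shows "f \<otimes>\<^bsub>power_series R\<^esub> g = g \<otimes>\<^bsub>power_series R\<^esub> f"
proof
  fix m :: "nat multiset"
  let ?S = "{p :: nat multiset \<times> nat multiset. fst p + snd p = m}"
  have S: "?S = prod.swap ` ?S"
  proof (intro equalityI subsetI)
    fix p assume "p \<in> ?S"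
    then show "p \<in> prod.swap ` ?S"
      by (intro image_eqI[of _ _ "prod.swap p"]) (auto simp: add.commute)
  qed (auto simp: add.commute)
  have "(\<Oplus>p\<in>?S. f (fst p) \<otimes> g (snd p)) = (\<Oplus>p\<in>prod.swap ` ?S. f (fst p) \<otimes> g (snd p))"
    by (simp flip: S)
  also have "\<dots> = (\<Oplus>p\<in>?S. g (fst p) \<otimes> f (snd p))"
    using assms by (subst finsum_reindex) (auto simp: power_series_simps m_comm)
  finally show "(f \<otimes>\<^bsub>power_series R\<^esub> g) m = (g \<otimes>\<^bsub>power_series R\<^esub> f) m"
    by (simp add: power_series_mult)
qed

lemma power_series_mult_assoc:
  assumes f: "f \<in> carrier (power_series R)" and g: "g \<in> carrier (power_series R)"
    and h: "h \<in> carrier (power_series R)"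
  shows "(f \<otimes>\<^bsub>power_series R\<^esub> g) \<otimes>\<^bsub>power_series R\<^esub> h =
         f \<otimes>\<^bsub>power_series R\<^esub> (g \<otimes>\<^bsub>power_series R\<^esub> h)"
proof
  fix m :: "nat multiset"
  let ?S = "\<lambda>m. {p :: nat multiset \<times> nat multiset. fst p + snd p = m}"
  let ?A = "SIGMA p:?S m. ?S (fst p)" and ?B = "SIGMA p:?S m. ?S (snd p)"
  \<comment> \<open>Both index sets encode decompositions of \<open>m\<close> into three multisets;
    \<open>?r\<close> rebrackets (a + b) + c as a + (b + c).\<close>
  let ?r = "\<lambda>(p :: nat multiset \<times> nat multiset, q :: nat multiset \<times> nat multiset).
              ((fst q, snd q + snd p), (snd q, snd p))"
  note [simp] = f[unfolded power_series_simps, rule_format] g[unfolded power_series_simps, rule_format]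
    h[unfolded power_series_simps, rule_format]
  have B: "?B = ?r ` ?A"
  proof (intro equalityI subsetI)
    fix z assume "z \<in> ?B"
    then show "z \<in> ?r ` ?A"
      by (intro image_eqI[of _ _ "((fst (fst z) + fst (snd z), snd (snd z)), (fst (fst z), fst (snd z)))"])
        (auto simp: add.assoc)
  qed (auto simp: add.assoc)
  have inj: "inj_on ?r ?A" by (auto simp: inj_on_def)
  have "((f \<otimes>\<^bsub>power_series R\<^esub> g) \<otimes>\<^bsub>power_series R\<^esub> h) m =
      (\<Oplus>p\<in>?S m. \<Oplus>q\<in>?S (fst p). (\<lambda>(p, q). f (fst q) \<otimes> g (snd q) \<otimes> h (snd p)) (p, q))"
    unfolding power_series_mult
    by (intro finsum_cong') (auto simp: finite_splittings finsum_ldistr intro!: finsum_closed)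
  also have "\<dots> = finsum R (\<lambda>(p, q). f (fst q) \<otimes> g (snd q) \<otimes> h (snd p)) ?A"
    by (rule finsum_Sigma) (auto simp: finite_splittings)
  also have "\<dots> = finsum R (\<lambda>(p, q). f (fst p) \<otimes> (g (fst q) \<otimes> h (snd q))) ?B"
    unfolding B by (subst finsum_reindex[OF _ inj]) (auto simp: m_assoc intro!: finsum_cong')
  also have "\<dots> = (\<Oplus>p\<in>?S m. \<Oplus>q\<in>?S (snd p). (\<lambda>(p, q). f (fst p) \<otimes> (g (fst q) \<otimes> h (snd q))) (p, q))"
    by (rule finsum_Sigma[symmetric]) (auto simp: finite_splittings)
  also have "\<dots> = (f \<otimes>\<^bsub>power_series R\<^esub> (g \<otimes>\<^bsub>power_series R\<^esub> h)) m"
    unfolding power_series_mult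
    by (intro finsum_cong') (auto simp: finite_splittings finsum_rdistr intro!: finsum_closed)
  finally show "((f \<otimes>\<^bsub>power_series R\<^esub> g) \<otimes>\<^bsub>power_series R\<^esub> h) m =
         (f \<otimes>\<^bsub>power_series R\<^esub> (g \<otimes>\<^bsub>power_series R\<^esub> h)) m" .
qed

lemma monomial_closed: "monomial R u \<in> carrier (power_series R)"
  by (simp add: monomial_def power_series_simps)

lemma monomial_mult:
  assumes "f \<in> carrier (power_series R)"
  shows "(monomial R u \<otimes>\<^bsub>power_series R\<^esub> f) m = (if u \<subseteq># m then f (m - u) else \<zero>)"
proof -
  let ?S = "{p :: nat multiset \<times> nat multiset. fst p + snd p = m}"
  have [simp]: "f n \<in> carrier R" for n using assms by (simp add: power_series_simps)
  \<comment> \<open>Only the splitting with first part \<open>u\<close> can contribute. As multiset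
    subtraction is truncated, \<open>(u, m - u)\<close> is a splitting of \<open>m\<close> exactly
    when \<open>u \<subseteq># m\<close>.\<close>
  have eq: "(monomial R u \<otimes>\<^bsub>power_series R\<^esub> f) m =
      (\<Oplus>p\<in>?S. if (u, m - u) = p then (\<lambda>p. f (snd p)) p else \<zero>)"
    unfolding power_series_mult by (rule finsum_cong') (auto simp: monomial_def)
  show ?thesis
  proof (cases "u \<subseteq># m")
    case True
    then show ?thesis
      unfolding eq by (subst add.finprod_singleton) (auto simp: finite_splittings)
  next
    case False
    then have "(\<Oplus>p\<in>?S. if (u, m - u) = p then (\<lambda>p. f (snd p)) p else \<zero>) = (\<Oplus>p\<in>?S. \<zero>)"
      by (intro finsum_cong') auto
    with False show ?thesis unfolding eq by simp
  qed
qed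

lemma one_power_series: "\<one>\<^bsub>power_series R\<^esub> = monomial R {#}"
  by (simp add: monomial_def power_series_def)

lemma var_eq_monomial: "var R n = monomial R {#n#}"
  by (simp add: monomial_def var_def)

lemma monomial_mult_monomial:
  "monomial R u \<otimes>\<^bsub>power_series R\<^esub> monomial R v = monomial R (u + v)"
proof
  fix m
  have "u \<subseteq># m \<and> m - u = v \<longleftrightarrow> m = u + v" by auto
  then show "(monomial R u \<otimes>\<^bsub>power_series R\<^esub> monomial R v) m = monomial R (u + v) m"
    by (subst monomial_mult) (auto simp: monomial_closed, auto simp: monomial_def)
qed

lemma power_series_cring: "cring (power_series R)"
proof (rule cringI)
  show "abelian_group (power_series R)"
  proof (rule abelian_groupI)
    fix f assume "f \<in> carrier (power_series R)"
    then show "\<exists>g\<in>carrier (power_series R). g \<oplus>\<^bsub>power_series R\<^esub> f = \<zero>\<^bsub>power_series R\<^esub>"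
      by (intro bexI[of _ "\<lambda>m. \<ominus> f m"]) (auto simp: power_series_simps fun_eq_iff l_neg)
  qed (auto simp: power_series_simps fun_eq_iff a_ac)
  show "comm_monoid (power_series R)"
  proof (rule comm_monoidI)
    fix f assume "f \<in> carrier (power_series R)"
    then show "\<one>\<^bsub>power_series R\<^esub> \<otimes>\<^bsub>power_series R\<^esub> f = f"
      unfolding one_power_series by (simp add: fun_eq_iff monomial_mult)
  qed (auto simp: power_series_mult_closed power_series_mult_assoc one_power_series monomial_closed
         intro: power_series_mult_comm)
  fix f g h
  assume "f \<in> carrier (power_series R)" "g \<in> carrier (power_series R)" "h \<in> carrier (power_series R)"
  then show "(f \<oplus>\<^bsub>power_series R\<^esub> g) \<otimes>\<^bsub>power_series R\<^esub> h =
      f \<otimes>\<^bsub>power_series R\<^esub> h \<oplus>\<^bsub>power_series R\<^esub> g \<otimes>\<^bsub>power_series R\<^esub> h"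
    by (auto simp: fun_eq_iff power_series_simps power_series_mult l_distr finsum_addf
        intro!: trans[OF _ finsum_addf] finsum_cong')
qed

lemma power_series_algebra: "algebra R (power_series R)"
proof (rule algebraI)
  fix c f g
  assume c: "c \<in> carrier R" and f: "f \<in> carrier (power_series R)" and g: "g \<in> carrier (power_series R)"
  show "(c \<odot>\<^bsub>power_series R\<^esub> f) \<otimes>\<^bsub>power_series R\<^esub> g = c \<odot>\<^bsub>power_series R\<^esub> (f \<otimes>\<^bsub>power_series R\<^esub> g)"
  proof
    fix m
    show "((c \<odot>\<^bsub>power_series R\<^esub> f) \<otimes>\<^bsub>power_series R\<^esub> g) m =
        (c \<odot>\<^bsub>power_series R\<^esub> (f \<otimes>\<^bsub>power_series R\<^esub> g)) m"
      using c f g unfolding power_series_simps power_series_mult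
      by (subst finsum_rdistr) (auto simp: finite_splittings m_assoc intro!: finsum_cong')
  qed
qed (auto simp: is_cring power_series_cring power_series_simps fun_eq_iff l_distr r_distr m_assoc)

end

section \<open>The shift and its iterated sum\<close>

text \<open>Truncated subtraction keeps the index 0 at 0, so \<open>lower\<close> inverts
  \<open>raise\<close> only on multisets without 0. The definitions built on it therefore branch on
  \<open>0 \<in># m\<close>.\<close>

abbreviation lower :: "nat multiset \<Rightarrow> nat multiset" where
  "lower m \<equiv> image_mset (\<lambda>n. n - Suc 0) m"

abbreviation raise :: "nat multiset \<Rightarrow> nat multiset" where
  "raise m \<equiv> image_mset Suc m"

lemma lower_raise: "lower (raise m) = m"
  by (simp add: multiset.map_comp comp_def)

lemma raise_lower: "0 \<notin># m \<Longrightarrow> raise (lower m) = m"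
  by (induction m) auto

text \<open>A monomial containing x_0 does not occur after the substitution, and any other one comes
  from its lowering. The empty multiset is its own lowering, so the constant term survives.\<close>

definition shift :: "('k, 'm) ring_scheme \<Rightarrow> (nat multiset \<Rightarrow> 'k) \<Rightarrow> nat multiset \<Rightarrow> 'k" where
  "shift k f m = (if 0 \<in># m then \<zero>\<^bsub>k\<^esub> else f (lower m))"

text \<open>Termination measure: each of the \<open>size m\<close> occurrences of an index drops by
  one. The empty multiset is a fixed point of \<open>lower\<close>, so the recursion has to stop
  there.\<close>

lemma sum_mset_lower_less:
  assumes "m \<noteq> {#}" "0 \<notin># m"
  shows "sum_mset (lower m) < sum_mset m"
proof -
  have "sum_mset m = sum_mset (lower m) + size m"
    using assms(2) by (induction m) auto
  with assms(1) show ?thesis by (simp add: nonempty_has_size)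
qed

text \<open>If \<open>f\<close> has zero constant term, this is the sum of the iterates
  \<open>shift k f\<close>, \<open>shift k (shift k f)\<close>, \<open>\<dots>\<close>\<close>

function shift_sum :: "('k, 'm) ring_scheme \<Rightarrow> (nat multiset \<Rightarrow> 'k) \<Rightarrow> nat multiset \<Rightarrow> 'k" where
  "shift_sum k f m =
     (if m = {#} \<or> 0 \<in># m then \<zero>\<^bsub>k\<^esub> else f (lower m) \<oplus>\<^bsub>k\<^esub> shift_sum k f (lower m))"
  by auto
termination
  by (relation "Wellfounded.measure (\<lambda>(k, f, m). sum_mset m)") (auto simp: sum_mset_lower_less)

declare shift_sum.simps [simp del]

lemma shift_sum_0: "m = {#} \<or> 0 \<in># m \<Longrightarrow> shift_sum k f m = \<zero>\<^bsub>k\<^esub>"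
  by (simp add: shift_sum.simps)

lemma shift_sum_lower:
  "m \<noteq> {#} \<Longrightarrow> 0 \<notin># m \<Longrightarrow> shift_sum k f m = f (lower m) \<oplus>\<^bsub>k\<^esub> shift_sum k f (lower m)"
  by (subst shift_sum.simps) simp

lemma shift_sum_raise:
  "m \<noteq> {#} \<Longrightarrow> shift_sum k f (raise m) = f m \<oplus>\<^bsub>k\<^esub> shift_sum k f m"
  by (subst shift_sum_lower) (auto simp: lower_raise)

text \<open>The case distinction of \<open>shift_sum\<close> as an induction rule, for comparing
  coefficients that obey its recursion.\<close>

lemma lower_induct [case_names zero lower]:
  assumes "\<And>m. m = {#} \<or> 0 \<in># m \<Longrightarrow> Q m"
    and "\<And>m. m \<noteq> {#} \<Longrightarrow> 0 \<notin># m \<Longrightarrow> Q (lower m) \<Longrightarrow> Q m"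
  shows "Q (m :: nat multiset)"
proof (induction "sum_mset m" arbitrary: m rule: less_induct)
  case less
  then show ?case
    using assms sum_mset_lower_less by blast
qed

section \<open>The Rota-Baxter identity for the sum of iterated shifts\<close>

context cring
begin

lemma shift_sum_closed:
  assumes "f \<in> carrier (power_series R)"
  shows "shift_sum R f \<in> carrier (power_series R)"
proof -
  have "shift_sum R f m \<in> carrier R" for m
    using assms by (induction m rule: lower_induct)
      (auto simp: shift_sum_0 shift_sum_lower power_series_simps)
  then show ?thesis by (simp add: power_series_simps)
qed

lemma shift_sum_add:
  assumes "f \<in> carrier (power_series R)" "g \<in> carrier (power_series R)"
  shows "shift_sum R (f \<oplus>\<^bsub>power_series R\<^esub> g) = shift_sum R f \<oplus>\<^bsub>power_series R\<^esub> shift_sum R g"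
proof
  fix m
  show "shift_sum R (f \<oplus>\<^bsub>power_series R\<^esub> g) m = (shift_sum R f \<oplus>\<^bsub>power_series R\<^esub> shift_sum R g) m"
    using assms shift_sum_closed[OF assms(1)] shift_sum_closed[OF assms(2)]
    by (induction m rule: lower_induct)
      (auto simp: shift_sum_0 shift_sum_lower power_series_simps a_ac)
qed

lemma shift_sum_smult:
  assumes "c \<in> carrier R" "f \<in> carrier (power_series R)"
  shows "shift_sum R (c \<odot>\<^bsub>power_series R\<^esub> f) = c \<odot>\<^bsub>power_series R\<^esub> shift_sum R f"
proof
  fix m
  show "shift_sum R (c \<odot>\<^bsub>power_series R\<^esub> f) m = (c \<odot>\<^bsub>power_series R\<^esub> shift_sum R f) m"
    using assms shift_sum_closed[OF assms(2)]
    by (induction m rule: lower_induct)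
      (auto simp: shift_sum_0 shift_sum_lower power_series_simps r_distr)
qed

text \<open>If 0 does not occur in \<open>m\<close>, raising both parts is a bijection from the
  splittings of \<open>lower m\<close> to those of \<open>m\<close>. If it does, every splitting has
  a part containing 0 and all terms vanish.\<close>

lemma shift_mult:
  assumes "f \<in> carrier (power_series R)" "g \<in> carrier (power_series R)"
  shows "shift R (f \<otimes>\<^bsub>power_series R\<^esub> g) = shift R f \<otimes>\<^bsub>power_series R\<^esub> shift R g"
proof
  fix m :: "nat multiset"
  let ?S = "\<lambda>m. {p :: nat multiset \<times> nat multiset. fst p + snd p = m}"
  have [simp]: "f m \<in> carrier R" "g m \<in> carrier R" for m
    using assms by (auto simp: power_series_simps)
  show "shift R (f \<otimes>\<^bsub>power_series R\<^esub> g) m = (shift R f \<otimes>\<^bsub>power_series R\<^esub> shift R g) m"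
  proof (cases "0 \<in># m")
    case True
    then have "(\<Oplus>p\<in>?S m. shift R f (fst p) \<otimes> shift R g (snd p)) = (\<Oplus>p\<in>?S m. \<zero>)"
      by (intro finsum_cong') (auto simp: shift_def)
    with True show ?thesis by (simp add: power_series_mult shift_def)
  next
    case False
    then have "?S m = map_prod raise raise ` ?S (lower m)"
    proof (intro equalityI subsetI)
      fix p assume p: "p \<in> ?S m"
      then have "0 \<notin># fst p" "0 \<notin># snd p" using False by auto
      then show "p \<in> map_prod raise raise ` ?S (lower m)"
        using p by (intro image_eqI[of _ _ "map_prod lower lower p"])
          (auto simp: raise_lower prod_eq_iff)
    next
      fix p assume "p \<in> map_prod raise raise ` ?S (lower m)"
      then obtain q where "p = map_prod raise raise q" "fst q + snd q = lower m" by auto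
      then show "p \<in> ?S m" using False
        by (simp flip: image_mset_union) (simp add: raise_lower)
    qed
    moreover have "inj_on (map_prod raise raise) (?S (lower m))"
      by (rule inj_onI) (metis lower_raise fst_map_prod snd_map_prod prod_eq_iff)
    ultimately have "(\<Oplus>p\<in>?S m. shift R f (fst p) \<otimes> shift R g (snd p)) =
        (\<Oplus>p\<in>?S (lower m). f (fst p) \<otimes> g (snd p))"
      by (simp add: finsum_reindex shift_def image_iff) (simp add: lower_raise)
    with False show ?thesis by (simp add: power_series_mult shift_def)
  qed
qed

text \<open>The sum of the iterates S^n over n >= 1 is S applied to the sum over n >= 0. The
  assumption on the constant term makes both sides agree at \<open>{#}\<close>, where
  \<open>shift\<close> changes nothing.\<close>

lemma shift_sum_eq_shift:
  assumes "f \<in> carrier (power_series R)" "f {#} = \<zero>"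
  shows "shift_sum R f = shift R (f \<oplus>\<^bsub>power_series R\<^esub> shift_sum R f)"
proof
  fix m
  show "shift_sum R f m = shift R (f \<oplus>\<^bsub>power_series R\<^esub> shift_sum R f) m"
    using assms by (cases "m = {#}") (auto simp: shift_def power_series_simps shift_sum_0 shift_sum_lower)
qed

text \<open>With \<open>P = shift_sum R\<close>, both sides solve \<open>y = shift R (h + y)\<close> for
  \<open>h = f P(g) + P(f) g + f g\<close>, which determines \<open>y\<close>.\<close>

lemma shift_sum_rota_baxter:
  assumes f: "f \<in> carrier (power_series R)" "f {#} = \<zero>"
    and g: "g \<in> carrier (power_series R)" "g {#} = \<zero>"
  shows "shift_sum R f \<otimes>\<^bsub>power_series R\<^esub> shift_sum R g =
         shift_sum R (f \<otimes>\<^bsub>power_series R\<^esub> shift_sum R g) \<oplus>\<^bsub>power_series R\<^esub>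
         shift_sum R (shift_sum R f \<otimes>\<^bsub>power_series R\<^esub> g) \<oplus>\<^bsub>power_series R\<^esub>
         shift_sum R (f \<otimes>\<^bsub>power_series R\<^esub> g)"
proof -
  interpret PS: cring "power_series R" by (rule power_series_cring)
  note cl = f(1) g(1) shift_sum_closed[OF f(1)] shift_sum_closed[OF g(1)]
  define h where "h = f \<otimes>\<^bsub>power_series R\<^esub> shift_sum R g \<oplus>\<^bsub>power_series R\<^esub>
    shift_sum R f \<otimes>\<^bsub>power_series R\<^esub> g \<oplus>\<^bsub>power_series R\<^esub> f \<otimes>\<^bsub>power_series R\<^esub> g"
  define y where "y = shift_sum R f \<otimes>\<^bsub>power_series R\<^esub> shift_sum R g"
  have h: "h \<in> carrier (power_series R)" and y: "y \<in> carrier (power_series R)"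
    unfolding h_def y_def using cl by auto
  have "y = shift R ((f \<oplus>\<^bsub>power_series R\<^esub> shift_sum R f) \<otimes>\<^bsub>power_series R\<^esub>
      (g \<oplus>\<^bsub>power_series R\<^esub> shift_sum R g))"
    unfolding y_def using cl shift_sum_eq_shift[OF f] shift_sum_eq_shift[OF g] by (simp add: shift_mult)
  also have "(f \<oplus>\<^bsub>power_series R\<^esub> shift_sum R f) \<otimes>\<^bsub>power_series R\<^esub>
      (g \<oplus>\<^bsub>power_series R\<^esub> shift_sum R g) = h \<oplus>\<^bsub>power_series R\<^esub> y"
    unfolding h_def y_def using cl by (simp add: PS.l_distr PS.r_distr PS.a_ac)
  finally have y_eq: "y = shift R (h \<oplus>\<^bsub>power_series R\<^esub> y)" .
  \<comment> \<open>At \<open>{#}\<close> the equation \<open>y_eq\<close> leaves \<open>y\<close>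
    undetermined, so its value there is computed directly.\<close>
  have y0: "y {#} = \<zero>"
  proof -
    have "{p. fst p + snd p = ({#} :: nat multiset)} = {({#}, {#})}" by (auto simp: prod_eq_iff)
    then show ?thesis by (simp add: y_def power_series_mult shift_sum_0)
  qed
  have "y m = shift_sum R h m" for m
  proof (induction m rule: lower_induct)
    case (zero m)
    then show ?case
      using y0 by (cases "m = {#}") (auto simp: shift_sum_0 y_eq[THEN fun_cong, of m] shift_def)
  next
    case (lower m)
    then show ?case
      by (subst y_eq) (simp add: shift_sum_lower shift_def power_series_simps)
  qed
  then have "y = shift_sum R h" by blast
  then show ?thesis
    unfolding y_def h_def using cl by (simp add: shift_sum_add)
qed

end

section \<open>Recursive description of the spanning family\<close>

lemma left_weak_compositions_Cons:
  "a # \<alpha> \<in> left_weak_compositions \<longleftrightarrow> (if \<alpha> = [] then a > 0 else \<alpha> \<in> left_weak_compositions)"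
  by (simp add: left_weak_compositions_def)

lemma left_weak_compositions_induct [consumes 1, case_names single Cons]:
  assumes "\<alpha> \<in> left_weak_compositions"
    and "\<And>a. a > 0 \<Longrightarrow> Q [a]"
    and "\<And>a \<alpha>. \<alpha> \<in> left_weak_compositions \<Longrightarrow> Q \<alpha> \<Longrightarrow> Q (a # \<alpha>)"
  shows "Q \<alpha>"
  using assms(1)
proof (induction \<alpha>)
  case Nil
  then show ?case by (simp add: left_weak_compositions_def)
next
  case (Cons a \<alpha>)
  then show ?case using assms(2,3) by (auto simp: left_weak_compositions_Cons split: if_splits)
qed

section \<open>Index sequences contributing to a given monomial\<close>

definition expo :: "nat list \<Rightarrow> nat list \<Rightarrow> nat multiset" where
  "expo ns \<alpha> = sum_list (map (\<lambda>(n, a). replicate_mset a n) (zip ns \<alpha>))"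

text \<open>The sequences that produce the monomial \<open>m\<close> in \<open>M_qsym\<close>.
  Coefficients of \<open>M_qsym\<close> count them, which reduces identities between series to
  counting.\<close>

definition occurrences :: "nat list \<Rightarrow> nat multiset \<Rightarrow> nat list set" where
  "occurrences \<alpha> m = {ns. length ns = length \<alpha> \<and> sorted_wrt (<) ns \<and> (\<forall>n\<in>set ns. 1 \<le> n) \<and> expo ns \<alpha> = m}"

lemma expo_simps [simp]:
  "expo [] \<alpha> = {#}"
  "expo (n # ns) (a # \<alpha>) = replicate_mset a n + expo ns \<alpha>"
  by (simp_all add: expo_def)

lemma expo_raise: "expo (map Suc ns) \<alpha> = raise (expo ns \<alpha>)"
proof (induction ns arbitrary: \<alpha>)
  case (Cons n ns)
  then show ?case by (cases \<alpha>) (auto simp: expo_def)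
qed simp

lemma set_expo: "set_mset (expo ns \<alpha>) \<subseteq> set ns"
proof (induction ns arbitrary: \<alpha>)
  case (Cons n ns)
  show ?case
  proof (cases \<alpha>)
    case (Cons a \<beta>)
    then show ?thesis using Cons.IH[of \<beta>] by (auto split: if_splits)
  qed (simp add: expo_def)
qed simp

text \<open>A positive last exponent makes the largest index visible in the monomial. This bounds
  all indices of a contributing sequence and is the source of local finiteness.\<close>

lemma last_in_expo:
  assumes "\<alpha> \<in> left_weak_compositions" "length ns = length \<alpha>"
  shows "last ns \<in># expo ns \<alpha>"
  using assms
proof (induction arbitrary: ns rule: left_weak_compositions_induct)
  case (single a)
  then show ?case by (cases ns) auto
next
  case (Cons a \<alpha>)
  then show ?case by (cases ns) (auto simp: left_weak_compositions_def)
qed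

lemma finite_occurrences:
  assumes "\<alpha> = [] \<or> \<alpha> \<in> left_weak_compositions"
  shows "finite (occurrences \<alpha> m)"
proof (cases "\<alpha> = []")
  case True
  then have "occurrences \<alpha> m \<subseteq> {[]}" by (auto simp: occurrences_def)
  then show ?thesis by (rule finite_subset) simp
next
  case False
  with assms have \<alpha>: "\<alpha> \<in> left_weak_compositions" by simp
  have "set ns \<subseteq> {..Max (set_mset m)}" if ns: "ns \<in> occurrences \<alpha> m" for ns
  proof
    fix n assume n: "n \<in> set ns"
    from ns have s: "sorted_wrt (<) ns" and l: "length ns = length \<alpha>" and e: "expo ns \<alpha> = m"
      by (auto simp: occurrences_def)
    have "n \<le> last ns"
      using n s by (cases ns rule: rev_cases) (auto simp: sorted_wrt_append)
    also have "last ns \<le> Max (set_mset m)"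
      using last_in_expo[OF \<alpha> l] unfolding e by (intro Max_ge) simp_all
    finally show "n \<in> {..Max (set_mset m)}" by simp
  qed
  moreover have "length ns = length \<alpha>" if "ns \<in> occurrences \<alpha> m" for ns
    using that by (simp add: occurrences_def)
  ultimately have "occurrences \<alpha> m \<subseteq> {ns. set ns \<subseteq> {..Max (set_mset m)} \<and> length ns = length \<alpha>}"
    by blast
  then show ?thesis
    by (rule finite_subset) (simp add: finite_lists_length_eq)
qed

text \<open>These are the monomials at which the recursion of \<open>shift_sum\<close> stops with
  value zero.\<close>

lemma occurrences_eq_empty:
  assumes "\<alpha> \<in> left_weak_compositions" "m = {#} \<or> 0 \<in># m"
  shows "occurrences \<alpha> m = {}"
proof -
  have False if ns: "ns \<in> occurrences \<alpha> m" for ns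
  proof -
    have "last ns \<in># m" using last_in_expo[OF assms(1), of ns] ns by (auto simp: occurrences_def)
    with assms(2) have "0 \<in> set ns"
      using set_expo[of ns \<alpha>] ns by (auto simp: occurrences_def)
    with ns show False by (auto simp: occurrences_def)
  qed
  then show ?thesis by blast
qed

text \<open>After lowering all indices by one, the first index is either \<open>0\<close> or still positive.\<close>

lemma occurrences_Cons:
  assumes "0 \<notin># m"
  shows "occurrences (b # \<beta>) m = map Suc `
    (Cons 0 ` (if replicate_mset b 0 \<subseteq># lower m then occurrences \<beta> (lower m - replicate_mset b 0) else {})
     \<union> occurrences (b # \<beta>) (lower m))" (is "_ = map Suc ` (Cons 0 ` ?A \<union> ?B)")
proof (intro equalityI subsetI)
  fix ns assume ns: "ns \<in> occurrences (b # \<beta>) m"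
  define ns' where "ns' = map (\<lambda>n. n - 1) ns"
  have ns_eq: "ns = map Suc ns'"
    unfolding ns'_def map_map using ns by (intro map_idI[symmetric]) (auto simp: occurrences_def)
  have "raise (expo ns' (b # \<beta>)) = m"
    using ns by (simp add: occurrences_def ns_eq expo_raise)
  then have e: "expo ns' (b # \<beta>) = lower m"
    by (metis lower_raise)
  have s: "sorted_wrt (<) ns'" "length ns' = length (b # \<beta>)"
    using ns by (auto simp: occurrences_def ns_eq sorted_wrt_map)
  obtain n t where t: "ns' = n # t" using s by (cases ns') auto
  have "ns' \<in> Cons 0 ` ?A \<union> ?B"
  proof (cases "n = 0")
    case True
    then have e': "replicate_mset b 0 + expo t \<beta> = lower m" using e t by simp
    then have "replicate_mset b 0 \<subseteq># lower m" by (metis mset_subset_eq_add_left)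
    moreover have "expo t \<beta> = lower m - replicate_mset b 0" using e' by (metis add_diff_cancel_left')
    ultimately have "t \<in> ?A" using s t True by (auto simp: occurrences_def)
    then show ?thesis using t True by blast
  next
    case False
    then have "ns' \<in> ?B" using e s t by (auto simp: occurrences_def)
    then show ?thesis by blast
  qed
  then show "ns \<in> map Suc ` (Cons 0 ` ?A \<union> ?B)" using ns_eq by blast
next
  fix ns assume "ns \<in> map Suc ` (Cons 0 ` ?A \<union> ?B)"
  then obtain ns' where ns': "ns = map Suc ns'" "ns' \<in> Cons 0 ` ?A \<union> ?B" by blast
  from ns'(2) have "sorted_wrt (<) ns' \<and> length ns' = length (b # \<beta>) \<and> expo ns' (b # \<beta>) = lower m"
  proof
    assume "ns' \<in> Cons 0 ` ?A"
    then show ?thesis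
      by (auto simp: occurrences_def Suc_le_eq split: if_splits)
  qed (auto simp: occurrences_def)
  then show "ns \<in> occurrences (b # \<beta>) m"
    using assms by (auto simp: occurrences_def ns'(1) sorted_wrt_map expo_raise raise_lower)
qed

text \<open>The two summands count the contributions of \<open>lower m\<close> to
  \<open>M_bar\<close> and to \<open>M_qsym\<close> for the same list, so this is the recursion of
  \<open>shift_sum\<close> before passing to the ring. The union is disjoint because only sequences
  of the first kind start with 0.\<close>

lemma card_occurrences_Cons:
  assumes "0 \<notin># m" "b # \<beta> \<in> left_weak_compositions"
  shows "card (occurrences (b # \<beta>) m) =
    (if replicate_mset b 0 \<subseteq># lower m then card (occurrences \<beta> (lower m - replicate_mset b 0)) else 0)
    + card (occurrences (b # \<beta>) (lower m))"
proof -
  define A where "A = (if replicate_mset b 0 \<subseteq># lower m then occurrences \<beta> (lower m - replicate_mset b 0) else {})"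
  have \<beta>: "\<beta> = [] \<or> \<beta> \<in> left_weak_compositions"
    using assms(2) by (simp add: left_weak_compositions_Cons split: if_splits)
  have "finite A" using finite_occurrences[OF \<beta>] by (simp add: A_def)
  moreover have "finite (occurrences (b # \<beta>) (lower m))" using assms(2) by (simp add: finite_occurrences)
  moreover have "Cons 0 ` A \<inter> occurrences (b # \<beta>) (lower m) = {}" by (auto simp: occurrences_def)
  ultimately have "card (Cons 0 ` A \<union> occurrences (b # \<beta>) (lower m)) = card A + card (occurrences (b # \<beta>) (lower m))"
    by (simp add: card_Un_disjoint card_image)
  moreover have inj: "inj_on (map Suc) X" for X
    by (rule inj_on_subset[of _ UNIV]) simp_all
  ultimately show ?thesis
    unfolding occurrences_Cons[OF assms(1)] A_def[symmetric]
    by (simp add: card_image[OF inj] A_def)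
qed

text \<open>The algebra has no unit to start from, hence the exponent \<open>a - 1\<close>; the value at \<open>[]\<close> and at
  lists ending in \<open>0\<close> is junk.\<close>

fun rb_word :: "('a, 'm) monoid_scheme \<Rightarrow> ('a \<Rightarrow> 'a) \<Rightarrow> 'a \<Rightarrow> nat list \<Rightarrow> 'a" where
  "rb_word A P x [] = x"
| "rb_word A P x [a] = ((\<lambda>y. x \<otimes>\<^bsub>A\<^esub> y) ^^ (a - 1)) x"
| "rb_word A P x (a # b # \<beta>) = ((\<lambda>y. x \<otimes>\<^bsub>A\<^esub> y) ^^ a) (P (rb_word A P x (b # \<beta>)))"

lemma rb_word_Cons:
  "\<alpha> \<in> left_weak_compositions \<Longrightarrow> rb_word A P x (a # \<alpha>) = ((\<lambda>y. x \<otimes>\<^bsub>A\<^esub> y) ^^ a) (P (rb_word A P x \<alpha>))"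
  by (cases \<alpha>) (auto simp: left_weak_compositions_def)

section \<open>The series \<open>M_bar\<close> as words in x_0\<close>

context cring
begin

lemma var_pow: "var R n [^]\<^bsub>power_series R\<^esub> (a :: nat) = monomial R (replicate_mset a n)"
proof -
  interpret PS: cring "power_series R" by (rule power_series_cring)
  show ?thesis
    by (induction a) (auto simp: one_power_series var_eq_monomial monomial_mult_monomial)
qed

lemma monomial_series_eq: "monomial_series R \<alpha> ns = monomial R (expo ns \<alpha>)"
proof -
  have "foldr (\<lambda>(n, a) f. (var R n [^]\<^bsub>power_series R\<^esub> a) \<otimes>\<^bsub>power_series R\<^esub> f) xs \<one>\<^bsub>power_series R\<^esub>
      = monomial R (sum_list (map (\<lambda>(n, a). replicate_mset a n) xs))" for xs :: "(nat \<times> nat) list"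
    by (induction xs) (auto simp: one_power_series var_pow monomial_mult_monomial)
  then show ?thesis by (simp add: monomial_series_def expo_def)
qed

text \<open>Each contributing sequence adds one unit. On an infinite set of sequences both sides
  default to zero, so the formula makes sense for every \<open>\<alpha>\<close>.\<close>

lemma M_qsym_eq: "M_qsym R \<alpha> m = [card (occurrences \<alpha> m)] \<cdot> \<one>"
proof (cases "\<one> = \<zero>")
  \<comment> \<open>In the zero ring \<open>series_sum\<close> discards every index, so its index
    set need not be \<open>occurrences \<alpha> m\<close>; but there all ring elements
    coincide.\<close>
  case True
  then have "carrier R = {\<zero>}" by (rule one_zeroD)
  moreover have "M_qsym R \<alpha> m \<in> carrier R"
    unfolding M_qsym_def series_sum_def monomial_series_eq
    by (rule finsum_closed) (auto simp: monomial_def)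
  ultimately show ?thesis
    using add.nat_pow_closed[OF one_closed] by auto
next
  case False
  then have "M_qsym R \<alpha> m = (\<Oplus>ns\<in>occurrences \<alpha> m. monomial R (expo ns \<alpha>) m)"
    unfolding M_qsym_def series_sum_def monomial_series_eq
    by (intro arg_cong[where f = "finsum R _"]) (auto simp: monomial_def occurrences_def)
  also have "\<dots> = (\<Oplus>ns\<in>occurrences \<alpha> m. \<one>)"
    by (intro finsum_cong') (auto simp: monomial_def occurrences_def)
  finally show ?thesis by (simp add: add.finprod_const)
qed

lemma M_qsym_closed: "M_qsym R \<alpha> \<in> carrier (power_series R)"
  by (simp add: power_series_simps M_qsym_eq)

lemma M_bar_coeff:
  "M_bar R (b # \<beta>) m =
    (if replicate_mset b 0 \<subseteq># m then M_qsym R \<beta> (m - replicate_mset b 0) else \<zero>)"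
  by (simp add: M_bar_def var_pow monomial_mult M_qsym_closed)

lemma M_bar_closed: "M_bar R \<alpha> \<in> carrier (power_series R)"
  unfolding M_bar_def var_pow by (intro power_series_mult_closed monomial_closed M_qsym_closed)

lemma M_qsym_Nil: "M_qsym R [] = \<one>\<^bsub>power_series R\<^esub>"
proof
  fix m
  have "occurrences [] m = (if m = {#} then {[]} else {})" by (auto simp: occurrences_def)
  then show "M_qsym R [] m = \<one>\<^bsub>power_series R\<^esub> m" by (simp add: M_qsym_eq power_series_simps)
qed

text \<open>Grouping the index sequences by their first index n yields the n-th shift of
  \<open>M_bar R \<alpha>\<close>. The counting recursion carries this out one shift at a
  time.\<close>

lemma M_qsym_eq_shift_sum:
  assumes "\<alpha> \<in> left_weak_compositions"
  shows "M_qsym R \<alpha> = shift_sum R (M_bar R \<alpha>)"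
proof
  fix m
  obtain b \<beta> where \<alpha>: "\<alpha> = b # \<beta>" using assms by (cases \<alpha>) (auto simp: left_weak_compositions_def)
  show "M_qsym R \<alpha> m = shift_sum R (M_bar R \<alpha>) m"
  proof (induction m rule: lower_induct)
    case (zero m)
    then show ?case by (simp add: M_qsym_eq occurrences_eq_empty[OF assms] shift_sum_0)
  next
    case (lower m)
    have "M_qsym R \<alpha> m = M_bar R \<alpha> (lower m) \<oplus> M_qsym R \<alpha> (lower m)"
      using card_occurrences_Cons[OF lower(2) assms[unfolded \<alpha>]]
      by (simp add: \<alpha> M_bar_coeff M_qsym_eq add.nat_pow_mult)
    with lower show ?case by (simp add: shift_sum_lower)
  qed
qed

lemma monomial_0_power_mult:
  assumes "f \<in> carrier (power_series R)"
  shows "((\<lambda>y. var R 0 \<otimes>\<^bsub>power_series R\<^esub> y) ^^ a) f = monomial R (replicate_mset a 0) \<otimes>\<^bsub>power_series R\<^esub> f"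
proof -
  interpret PS: cring "power_series R" by (rule power_series_cring)
  show ?thesis
    using assms by (induction a)
      (simp_all add: var_eq_monomial monomial_closed monomial_mult_monomial
        flip: one_power_series PS.m_assoc)
qed

lemma M_bar_single: "a > 0 \<Longrightarrow> M_bar R [a] = monomial R (replicate_mset a 0)"
proof -
  interpret PS: cring "power_series R" by (rule power_series_cring)
  show ?thesis by (simp add: M_bar_def M_qsym_Nil var_pow monomial_closed)
qed

lemma M_bar_Cons:
  assumes "\<alpha> \<in> left_weak_compositions"
  shows "M_bar R (a # \<alpha>) = monomial R (replicate_mset a 0) \<otimes>\<^bsub>power_series R\<^esub> shift_sum R (M_bar R \<alpha>)"
  using assms by (simp add: M_bar_def M_qsym_eq_shift_sum var_pow)

lemma M_bar_1: "M_bar R [1] = var R 0"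
  by (simp add: M_bar_single var_eq_monomial)

text \<open>Words depend only on the multiplication and on the values of the operator at the family.
  In this generality the lemma serves both the ideal of series without constant term with
  \<open>shift_sum\<close> and the span with its own operator.\<close>

lemma M_bar_eq_rb_word:
  assumes "\<alpha> \<in> left_weak_compositions"
    and A: "mult A = mult (power_series R)"
    and P: "\<And>\<beta>. \<beta> \<in> left_weak_compositions \<Longrightarrow> P (M_bar R \<beta>) = shift_sum R (M_bar R \<beta>)"
  shows "M_bar R \<alpha> = rb_word A P (M_bar R [1]) \<alpha>"
  using assms(1)
proof (induction rule: left_weak_compositions_induct)
  case (single a)
  then obtain n where "a = Suc n" by (cases a) auto
  moreover have "replicate_mset n 0 + {#0#} = replicate_mset (Suc n) (0 :: nat)" by simp
  ultimately show ?case
    by (simp only: A M_bar_single[OF zero_less_Suc] M_bar_1 rb_word.simps diff_Suc_1 monomial_0_power_mult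
        var_eq_monomial monomial_closed monomial_mult_monomial
        monomial_0_power_mult[unfolded var_eq_monomial])
next
  case (Cons a \<alpha>)
  then show ?case
    unfolding M_bar_Cons[OF Cons(1)] rb_word_Cons[OF Cons(1)] Cons.IH[symmetric] P[OF Cons(1)] A
    unfolding M_bar_1 by (simp add: monomial_0_power_mult shift_sum_closed M_bar_closed)
qed

lemma M_bar_const_coeff:
  assumes "\<alpha> \<in> left_weak_compositions"
  shows "M_bar R \<alpha> {#} = \<zero>"
  using assms
proof (induction rule: left_weak_compositions_induct)
  case (single a)
  then show ?case by (simp add: M_bar_single monomial_def)
next
  case (Cons a \<alpha>)
  then show ?case by (simp add: M_bar_Cons monomial_mult shift_sum_closed M_bar_closed shift_sum_0)
qed

end

section \<open>Words in a Rota--Baxter algebra\<close>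

text \<open>Locale form of \<open>comm_rota_baxter_algebra\<close>, so that computations with words
  can be interpreted in algebras of power series as well as in an arbitrary target.\<close>

locale comm_rota_baxter = nonunital_comm_algebra k A for k (structure) and A (structure) and P +
  assumes rota_baxter_operator: "rota_baxter_operator k A P"

lemma comm_rota_baxter_algebra_iff: "comm_rota_baxter_algebra k A P \<longleftrightarrow> comm_rota_baxter k A P"
  by (simp add: comm_rota_baxter_algebra_def comm_rota_baxter_def comm_rota_baxter_axioms_def)

context comm_rota_baxter
begin

lemma P_closed: "y \<in> carrier A \<Longrightarrow> P y \<in> carrier A"
  using rota_baxter_operator by (auto simp: rota_baxter_operator_def linear_map_def)

lemma rota_baxter_eq:
  "y \<in> carrier A \<Longrightarrow> z \<in> carrier A \<Longrightarrow>
    P y \<otimes>\<^bsub>A\<^esub> P z = P (y \<otimes>\<^bsub>A\<^esub> P z) \<oplus>\<^bsub>A\<^esub> P (P y \<otimes>\<^bsub>A\<^esub> z) \<oplus>\<^bsub>A\<^esub> P (y \<otimes>\<^bsub>A\<^esub> z)"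
  using rota_baxter_operator by (auto simp: rota_baxter_operator_def)

lemma funpow_mult_closed:
  "x \<in> carrier A \<Longrightarrow> y \<in> carrier A \<Longrightarrow> ((\<lambda>y. x \<otimes>\<^bsub>A\<^esub> y) ^^ n) y \<in> carrier A"
  by (induction n) (auto intro: mult_closed)

lemma funpow_mult_assoc:
  "x \<in> carrier A \<Longrightarrow> y \<in> carrier A \<Longrightarrow> z \<in> carrier A \<Longrightarrow>
    ((\<lambda>y. x \<otimes>\<^bsub>A\<^esub> y) ^^ n) y \<otimes>\<^bsub>A\<^esub> z = ((\<lambda>y. x \<otimes>\<^bsub>A\<^esub> y) ^^ n) (y \<otimes>\<^bsub>A\<^esub> z)"
  by (induction n) (auto simp: mult_assoc funpow_mult_closed)

lemma rb_word_closed: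
  assumes "x \<in> carrier A"
  shows "rb_word A P x \<alpha> \<in> carrier A"
proof (induction \<alpha>)
  case (Cons a \<alpha>)
  then show ?case using assms by (cases \<alpha>) (auto intro: funpow_mult_closed P_closed)
qed (simp add: assms)

text \<open>The word ends in \<open>x\<close> in place of a unit; this last \<open>x\<close>
  supplies the factor missing from the exponent \<open>a - 1\<close>.\<close>

lemma rb_word_single_mult:
  assumes "a > 0" "x \<in> carrier A" "y \<in> carrier A"
  shows "rb_word A P x [a] \<otimes>\<^bsub>A\<^esub> y = ((\<lambda>y. x \<otimes>\<^bsub>A\<^esub> y) ^^ a) y"
  using assms by (cases a) (auto simp: funpow_mult_assoc funpow_swap1)

text \<open>Associativity and commutativity move all factors \<open>x\<close> to the front, and the
  Rota-Baxter identity applies to what remains. Writing the image of a word under \<open>P\<close>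
  as the word with a 0 prefixed keeps the right-hand side in terms of products of words, now of
  smaller total length.\<close>

lemma rb_word_Cons_mult:
  assumes \<alpha>: "\<alpha> \<in> left_weak_compositions" and \<beta>: "\<beta> \<in> left_weak_compositions"
    and x: "x \<in> carrier A"
  shows "rb_word A P x (a # \<alpha>) \<otimes>\<^bsub>A\<^esub> rb_word A P x (b # \<beta>) =
    ((\<lambda>y. x \<otimes>\<^bsub>A\<^esub> y) ^^ (a + b))
      (P (rb_word A P x \<alpha> \<otimes>\<^bsub>A\<^esub> rb_word A P x (0 # \<beta>)) \<oplus>\<^bsub>A\<^esub>
       P (rb_word A P x (0 # \<alpha>) \<otimes>\<^bsub>A\<^esub> rb_word A P x \<beta>) \<oplus>\<^bsub>A\<^esub>
       P (rb_word A P x \<alpha> \<otimes>\<^bsub>A\<^esub> rb_word A P x \<beta>))"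
proof -
  let ?u = "rb_word A P x \<alpha>" and ?v = "rb_word A P x \<beta>" and ?X = "\<lambda>n. (\<lambda>y. x \<otimes>\<^bsub>A\<^esub> y) ^^ n"
  note cl = rb_word_closed[OF x, of \<alpha>] rb_word_closed[OF x, of \<beta>] P_closed funpow_mult_closed[OF x] mult_closed
  have "?X a (P ?u) \<otimes>\<^bsub>A\<^esub> ?X b (P ?v) = ?X a (P ?u \<otimes>\<^bsub>A\<^esub> ?X b (P ?v))"
    using x cl by (simp add: funpow_mult_assoc)
  also have "P ?u \<otimes>\<^bsub>A\<^esub> ?X b (P ?v) = ?X b (P ?v \<otimes>\<^bsub>A\<^esub> P ?u)"
    using x cl by (simp add: mult_comm[of "P ?u"] funpow_mult_assoc)
  also have "P ?v \<otimes>\<^bsub>A\<^esub> P ?u = P ?u \<otimes>\<^bsub>A\<^esub> P ?v"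
    using cl by (simp add: mult_comm)
  finally show ?thesis
    using cl by (simp add: rb_word_Cons \<alpha> \<beta> funpow_add rota_baxter_eq)
qed

text \<open>Words are built from \<open>x\<close> by the product and the operator alone. The values
  of a homomorphism on words are therefore forced, which gives uniqueness.\<close>

lemma hom_rb_word:
  assumes h: "rota_baxter_hom k A P B Q h" and x: "x \<in> carrier A"
  shows "h (rb_word A P x \<alpha>) = rb_word B Q (h x) \<alpha>"
proof -
  have X: "h (((\<lambda>y. x \<otimes>\<^bsub>A\<^esub> y) ^^ n) y) = ((\<lambda>y. h x \<otimes>\<^bsub>B\<^esub> y) ^^ n) (h y)" if "y \<in> carrier A" for y n
    using h x that by (induction n) (auto simp: rota_baxter_hom_def funpow_mult_closed)
  show ?thesis
  proof (induction \<alpha>)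
    case (Cons a \<alpha>)
    then show ?case
      using h x by (cases \<alpha>) (auto simp: X rota_baxter_hom_def P_closed rb_word_closed)
  qed simp
qed

end

text \<open>Follows the recursion for products of words. Prefixing 0 to one factor still lowers the
  total length, since both factors have lost a letter; \<open>comm\<close> turns a single letter on
  the right into one on the left.\<close>

lemma product_induct [consumes 2, case_names single comm Cons]:
  assumes "\<alpha> \<in> left_weak_compositions" "\<beta> \<in> left_weak_compositions"
    and single: "\<And>a \<beta>. a > 0 \<Longrightarrow> \<beta> \<in> left_weak_compositions \<Longrightarrow> Q [a] \<beta>"
    and comm: "\<And>\<alpha> \<beta>. \<alpha> \<in> left_weak_compositions \<Longrightarrow> \<beta> \<in> left_weak_compositions \<Longrightarrow> Q \<alpha> \<beta> \<Longrightarrow> Q \<beta> \<alpha>"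
    and Cons: "\<And>a b \<alpha> \<beta>. \<alpha> \<in> left_weak_compositions \<Longrightarrow> \<beta> \<in> left_weak_compositions \<Longrightarrow>
      Q \<alpha> (0 # \<beta>) \<Longrightarrow> Q (0 # \<alpha>) \<beta> \<Longrightarrow> Q \<alpha> \<beta> \<Longrightarrow> Q (a # \<alpha>) (b # \<beta>)"
  shows "Q \<alpha> \<beta>"
  using assms(1,2)
proof (induction "length \<alpha> + length \<beta>" arbitrary: \<alpha> \<beta> rule: less_induct)
  case less
  obtain a \<alpha>' b \<beta>' where ab: "\<alpha> = a # \<alpha>'" "\<beta> = b # \<beta>'"
    using less.prems by (cases \<alpha>; cases \<beta>) (auto simp: left_weak_compositions_def)
  consider "\<alpha>' = []" | "\<beta>' = []" | "\<alpha>' \<in> left_weak_compositions" "\<beta>' \<in> left_weak_compositions"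
    using less.prems unfolding ab left_weak_compositions_Cons by (auto split: if_splits)
  then show ?case
  proof cases
    case 1
    then show ?thesis using less.prems by (auto simp: ab left_weak_compositions_Cons intro!: single)
  next
    case 2
    then have "Q [b] \<alpha>" using less.prems by (auto simp: ab left_weak_compositions_Cons intro!: single)
    then show ?thesis using 2 less.prems comm by (simp add: ab)
  next
    case 3
    moreover have "0 # \<alpha>' \<in> left_weak_compositions" "0 # \<beta>' \<in> left_weak_compositions"
      using 3 by (auto simp: left_weak_compositions_def)
    ultimately show ?thesis
      unfolding ab by (intro Cons less.hyps) (auto simp: ab)
  qed
qed

section \<open>The dual basis\<close>

text \<open>\<open>coeff_peel k a\<close> extracts the coefficient of \<open>x\<^sub>0\<^sup>a\<close> and inverts \<open>shift_sum k\<close> on it,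
  killing constants.\<close>

definition coeff_peel :: "('k, 'm) ring_scheme \<Rightarrow> nat \<Rightarrow> (nat multiset \<Rightarrow> 'k) \<Rightarrow> nat multiset \<Rightarrow> 'k" where
  "coeff_peel k a f m = f (raise m + replicate_mset a 0) \<ominus>\<^bsub>k\<^esub>
     (if 0 \<in># m then \<zero>\<^bsub>k\<^esub> else f (m + replicate_mset a 0))"

text \<open>The coordinate functional of a word: all letters but the last are peeled off, and the
  last is read as the coefficient of a pure power of x_0. The value at \<open>[]\<close> is a
  default.\<close>

fun coeff_bar :: "('k, 'm) ring_scheme \<Rightarrow> nat list \<Rightarrow> (nat multiset \<Rightarrow> 'k) \<Rightarrow> 'k" where
  "coeff_bar k [] f = \<zero>\<^bsub>k\<^esub>"
| "coeff_bar k [a] f = f (replicate_mset a 0)"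
| "coeff_bar k (a # b # \<beta>) f = coeff_bar k (b # \<beta>) (coeff_peel k a f)"

section \<open>Duality between coordinates and words\<close>

context cring
begin

lemma coeff_peel_closed:
  "f \<in> carrier (power_series R) \<Longrightarrow> coeff_peel R a f \<in> carrier (power_series R)"
  by (simp add: power_series_simps coeff_peel_def)

lemma coeff_peel_add:
  assumes "f \<in> carrier (power_series R)" "g \<in> carrier (power_series R)"
  shows "coeff_peel R a (f \<oplus>\<^bsub>power_series R\<^esub> g) = coeff_peel R a f \<oplus>\<^bsub>power_series R\<^esub> coeff_peel R a g"
  using assms by (auto simp: fun_eq_iff power_series_simps coeff_peel_def a_minus_def minus_add a_ac)

lemma coeff_peel_smult:
  assumes "c \<in> carrier R" "f \<in> carrier (power_series R)"
  shows "coeff_peel R a (c \<odot>\<^bsub>power_series R\<^esub> f) = c \<odot>\<^bsub>power_series R\<^esub> coeff_peel R a f"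
  using assms by (auto simp: fun_eq_iff power_series_simps coeff_peel_def a_minus_def r_distr r_minus)

lemma coeff_bar_closed:
  "f \<in> carrier (power_series R) \<Longrightarrow> coeff_bar R \<alpha> f \<in> carrier R"
proof (induction \<alpha> arbitrary: f)
  case (Cons a \<alpha>)
  show ?case
  proof (cases \<alpha>)
    case Nil
    then show ?thesis using Cons.prems by (simp add: power_series_simps)
  next
    case (Cons b \<beta>)
    then show ?thesis using Cons.IH Cons.prems coeff_peel_closed by simp
  qed
qed simp

lemma coeff_bar_add:
  assumes "f \<in> carrier (power_series R)" "g \<in> carrier (power_series R)"
  shows "coeff_bar R \<alpha> (f \<oplus>\<^bsub>power_series R\<^esub> g) = coeff_bar R \<alpha> f \<oplus> coeff_bar R \<alpha> g"
  using assms
proof (induction \<alpha> arbitrary: f g)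
  case (Cons a \<alpha>)
  show ?case
  proof (cases \<alpha>)
    case Nil
    then show ?thesis by (simp add: power_series_simps)
  next
    case (Cons b \<beta>)
    then show ?thesis using Cons.IH Cons.prems by (simp add: coeff_peel_add coeff_peel_closed)
  qed
qed simp

lemma coeff_bar_smult:
  assumes "c \<in> carrier R" "f \<in> carrier (power_series R)"
  shows "coeff_bar R \<alpha> (c \<odot>\<^bsub>power_series R\<^esub> f) = c \<otimes> coeff_bar R \<alpha> f"
  using assms
proof (induction \<alpha> arbitrary: f)
  case (Cons a \<alpha>)
  show ?case
  proof (cases \<alpha>)
    case Nil
    then show ?thesis by (simp add: power_series_simps)
  next
    case (Cons b \<beta>)
    then show ?thesis using Cons.IH Cons.prems by (simp add: coeff_peel_smult coeff_peel_closed)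
  qed
qed simp

lemma coeff_bar_zero: "coeff_bar R \<alpha> (\<lambda>m. \<zero>) = \<zero>"
  using coeff_bar_smult[of \<zero> "\<lambda>m. \<zero>" \<alpha>] coeff_bar_closed[of "\<lambda>m. \<zero>" \<alpha>]
  by (simp add: power_series_def)

text \<open>As \<open>f\<close> is free of x_0, only \<open>b = a\<close> contributes to monomials
  with exactly \<open>a\<close> factors x_0. If \<open>0 \<in># m\<close>, the second coefficient in
  \<open>coeff_peel\<close> would belong to a higher power of x_0; its replacement by zero agrees
  with \<open>f m\<close>, which vanishes by assumption.\<close>

lemma coeff_peel_monomial_mult:
  assumes f: "f \<in> carrier (power_series R)" and 0: "\<And>m. 0 \<in># m \<Longrightarrow> f m = \<zero>"
  shows "coeff_peel R a (monomial R (replicate_mset b 0) \<otimes>\<^bsub>power_series R\<^esub> f) m =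
    (if a = b then f (raise m) \<ominus> f m else \<zero>)"
proof -
  have *: "(monomial R (replicate_mset b 0) \<otimes>\<^bsub>power_series R\<^esub> f) (m + replicate_mset a 0) =
      (if a = b then f m else \<zero>)" if m: "0 \<notin># m" for m
  proof -
    have c: "count m 0 = 0" using m by (simp add: not_in_iff)
    consider "a < b" | "a = b" | "b < a" by linarith
    then show ?thesis
    proof cases
      case 1
      then have "\<not> replicate_mset b 0 \<subseteq># m + replicate_mset a 0"
        using c mset_subset_eq_count[of "replicate_mset b 0" "m + replicate_mset a 0" 0] by auto
      with 1 show ?thesis by (simp add: monomial_mult f)
    next
      case 3
      have sub: "replicate_mset b 0 \<subseteq># m + replicate_mset a 0"
        using 3 by (auto simp: subseteq_mset_def)
      have "count (m + replicate_mset a 0 - replicate_mset b 0) 0 = a - b"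
        using c by simp
      then have "0 \<in># m + replicate_mset a 0 - replicate_mset b 0"
        using 3 by (metis count_eq_zero_iff diff_is_0_eq not_le)
      with 3 sub show ?thesis by (simp add: monomial_mult f 0)
    qed (simp add: monomial_mult f)
  qed
  have cl: "f m \<in> carrier R" for m using f by (simp add: power_series_simps)
  show ?thesis
    using cl 0[of m] *[of m] *[of "raise m"] by (auto simp: coeff_peel_def a_minus_def)
qed

text \<open>A pure power of x_0 is that power times the constant series 1, and the difference
  between the coefficients at \<open>raise m\<close> and at \<open>m\<close> vanishes for a
  constant.\<close>

lemma coeff_peel_M_bar_single:
  assumes "b > 0" shows "coeff_peel R a (M_bar R [b]) = (\<lambda>m. \<zero>)"
proof
  fix m
  interpret PS: cring "power_series R" by (rule power_series_cring)
  have "M_bar R [b] = monomial R (replicate_mset b 0) \<otimes>\<^bsub>power_series R\<^esub> \<one>\<^bsub>power_series R\<^esub>"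
    by (simp add: M_bar_single assms monomial_closed)
  then show "coeff_peel R a (M_bar R [b]) m = \<zero>"
    by (subst \<open>M_bar R [b] = _\<close>, subst coeff_peel_monomial_mult) (auto simp: power_series_simps a_minus_def r_neg)
qed

lemma coeff_peel_M_bar_Cons:
  assumes "\<beta> \<in> left_weak_compositions"
  shows "coeff_peel R a (M_bar R (b # \<beta>)) = (if a = b then M_bar R \<beta> else (\<lambda>m. \<zero>))"
proof
  fix m
  let ?g = "M_bar R \<beta>"
  have cl: "?g m \<in> carrier R" "shift_sum R ?g m \<in> carrier R" for m
    using M_bar_closed[of \<beta>] shift_sum_closed[OF M_bar_closed] by (auto simp: power_series_simps)
  have "shift_sum R ?g (raise m) \<ominus> shift_sum R ?g m = ?g m"
  \<comment> \<open>\<open>shift_sum_raise\<close> excludes the empty multiset. There the difference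
    is zero, and so is the constant coefficient of \<open>?g\<close>.\<close>
  proof (cases "m = {#}")
    case True
    then show ?thesis by (simp add: shift_sum_0 M_bar_const_coeff assms a_minus_def)
  next
    case False
    then show ?thesis using cl by (simp add: shift_sum_raise a_minus_def a_assoc r_neg)
  qed
  then show "coeff_peel R a (M_bar R (b # \<beta>)) m = (if a = b then ?g else (\<lambda>m. \<zero>)) m"
    unfolding M_bar_Cons[OF assms]
    by (subst coeff_peel_monomial_mult) (auto simp: shift_sum_closed M_bar_closed shift_sum_0)
qed

text \<open>Peeling strips the first letter of \<open>\<beta>\<close> if it agrees with that of
  \<open>\<alpha>\<close> and gives zero otherwise. Words of different lengths separate at the end:
  a pure power of x_0 is peeled to zero, and a longer word contains no pure power of x_0.\<close>

lemma coeff_bar_M_bar: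
  assumes "\<alpha> \<in> left_weak_compositions" "\<beta> \<in> left_weak_compositions"
  shows "coeff_bar R \<alpha> (M_bar R \<beta>) = (if \<alpha> = \<beta> then \<one> else \<zero>)"
  using assms
proof (induction arbitrary: \<beta> rule: left_weak_compositions_induct)
  case (single a)
  obtain b \<beta>' where \<beta>: "\<beta> = b # \<beta>'"
    using single.prems by (cases \<beta>) (auto simp: left_weak_compositions_def)
  show ?case
  proof (cases "\<beta>' = []")
    case True
    then have "b > 0" using single.prems by (simp add: \<beta> left_weak_compositions_Cons)
    then show ?thesis using True by (auto simp: \<beta> M_bar_single monomial_def replicate_mset_eq_iff)
  next
    case False
    then have "\<beta>' \<in> left_weak_compositions" using single.prems by (simp add: \<beta> left_weak_compositions_Cons)
    moreover have "replicate_mset a 0 - replicate_mset b 0 = replicate_mset (a - b) (0 :: nat)"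
      by (rule multiset_eqI) simp
    ultimately show ?thesis using False
      by (simp add: \<beta> M_bar_Cons monomial_mult shift_sum_closed M_bar_closed shift_sum_0)
  qed
next
  case (Cons a \<alpha>)
  have \<alpha>: "coeff_bar R (a # \<alpha>) f = coeff_bar R \<alpha> (coeff_peel R a f)" for f
    using Cons(1) by (cases \<alpha>) (auto simp: left_weak_compositions_def)
  obtain b \<beta>' where \<beta>: "\<beta> = b # \<beta>'" using Cons.prems by (cases \<beta>) (auto simp: left_weak_compositions_def)
  show ?case
  proof (cases "\<beta>' = []")
    case True
    then show ?thesis using Cons.prems Cons(1)
      by (auto simp: \<alpha> \<beta> coeff_peel_M_bar_single coeff_bar_zero left_weak_compositions_def)
  next
    case False
    then have "\<beta>' \<in> left_weak_compositions" using Cons.prems by (simp add: \<beta> left_weak_compositions_Cons)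
    then show ?thesis using Cons.IH[of \<beta>']
      by (auto simp: \<alpha> \<beta> coeff_peel_M_bar_Cons coeff_bar_zero)
  qed
qed

end

section \<open>The algebra spanned by the family\<close>

context module
begin

lemma submoduleI':
  assumes "H \<subseteq> carrier M" "\<zero>\<^bsub>M\<^esub> \<in> H"
    and "\<And>x y. x \<in> H \<Longrightarrow> y \<in> H \<Longrightarrow> x \<oplus>\<^bsub>M\<^esub> y \<in> H"
    and smult: "\<And>c x. c \<in> carrier R \<Longrightarrow> x \<in> H \<Longrightarrow> c \<odot>\<^bsub>M\<^esub> x \<in> H"
  shows "submodule H R M"
proof (rule submoduleI)
  fix x assume "x \<in> H"
  then show "\<ominus>\<^bsub>M\<^esub> x \<in> H"
    using smult[of "\<ominus> \<one>" x] assms(1) by (auto simp: smult_l_minus)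
qed (use assms in auto)

lemma module_span_superset: "S \<subseteq> module_span R M S"
  by (auto simp: module_span_def)

lemma module_span_closed: "S \<subseteq> carrier M \<Longrightarrow> module_span R M S \<subseteq> carrier M"
  using carrier_is_submodule by (auto simp: module_span_def)

lemma submodule_module_span:
  assumes "S \<subseteq> carrier M"
  shows "submodule (module_span R M S) R M"
proof (rule submoduleI')
  show "module_span R M S \<subseteq> carrier M" by (rule module_span_closed[OF assms])
next
  have "\<zero>\<^bsub>M\<^esub> \<in> H" if "submodule H R M" for H
    using submoduleE[OF that] by (metis M.r_neg ex_in_conv subset_iff)
  then show "\<zero>\<^bsub>M\<^esub> \<in> module_span R M S" by (auto simp: module_span_def)
qed (auto simp: module_span_def dest: submoduleE)

lemma module_span_induct [consumes 2, case_names base zero add smult]: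
  assumes S: "S \<subseteq> carrier M" and x: "x \<in> module_span R M S"
    and base: "\<And>x. x \<in> S \<Longrightarrow> Q x" and zero: "Q \<zero>\<^bsub>M\<^esub>"
    and add: "\<And>x y. x \<in> module_span R M S \<Longrightarrow> y \<in> module_span R M S \<Longrightarrow> Q x \<Longrightarrow> Q y \<Longrightarrow> Q (x \<oplus>\<^bsub>M\<^esub> y)"
    and smult: "\<And>c x. c \<in> carrier R \<Longrightarrow> x \<in> module_span R M S \<Longrightarrow> Q x \<Longrightarrow> Q (c \<odot>\<^bsub>M\<^esub> x)"
  shows "Q x"
proof -
  note V = submoduleE[OF submodule_module_span[OF S]]
  \<comment> \<open>Cutting down to the span makes the membership premises of \<open>add\<close> and
    \<open>smult\<close> available.\<close>
  have "submodule {x \<in> module_span R M S. Q x} R M"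
  proof (rule submoduleI')
    show "\<zero>\<^bsub>M\<^esub> \<in> {x \<in> module_span R M S. Q x}"
      using zero V by (metis (mono_tags, lifting) M.r_neg ex_in_conv mem_Collect_eq subset_iff)
  qed (use V add smult in auto)
  then have "module_span R M S \<subseteq> {x \<in> module_span R M S. Q x}"
    using base module_span_superset[of S] unfolding module_span_def by blast
  with x show ?thesis by blast
qed

end

lemma linear_map_zero:
  assumes "module k A" "module k B" "linear_map k A B f"
  shows "f \<zero>\<^bsub>A\<^esub> = \<zero>\<^bsub>B\<^esub>"
proof -
  interpret A: module k A by fact
  interpret B: module k B by fact
  have "f (\<zero>\<^bsub>k\<^esub> \<odot>\<^bsub>A\<^esub> \<zero>\<^bsub>A\<^esub>) = \<zero>\<^bsub>k\<^esub> \<odot>\<^bsub>B\<^esub> f \<zero>\<^bsub>A\<^esub>"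
    using assms(3) by (auto simp: linear_map_def simp del: A.smult_l_null A.smult_r_null)
  moreover have "f \<zero>\<^bsub>A\<^esub> \<in> carrier B" using assms(3) by (auto simp: linear_map_def)
  ultimately show ?thesis by simp
qed

text \<open>The new operator has to agree with the old one only on \<open>H\<close>, so an operator
  cut off outside the span still inherits the identity.\<close>

lemma comm_rota_baxter_subalgebra:
  assumes "comm_rota_baxter k A P" and H: "submodule H k A"
    and mult: "\<And>x y. x \<in> H \<Longrightarrow> y \<in> H \<Longrightarrow> x \<otimes>\<^bsub>A\<^esub> y \<in> H"
    and P: "\<And>x. x \<in> H \<Longrightarrow> P x \<in> H" and P': "\<And>x. x \<in> H \<Longrightarrow> P' x = P x"
  shows "comm_rota_baxter k (A\<lparr>carrier := H\<rparr>) P'"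
proof -
  interpret A: comm_rota_baxter k A P by fact
  interpret H: module k "A\<lparr>carrier := H\<rparr>"
    by (rule submodule.submodule_is_module[OF H A.module_axioms])
  note V = A.submoduleE[OF H]
  note P_simps = A.rota_baxter_operator[unfolded rota_baxter_operator_def linear_map_def]
  show ?thesis
  proof unfold_locales
    show "rota_baxter_operator k (A\<lparr>carrier := H\<rparr>) P'"
      using P_simps V mult P unfolding rota_baxter_operator_def linear_map_def
      by (auto simp: P' subset_iff)
  qed (use V mult in \<open>auto simp: subset_iff A.mult_assoc A.mult_add_distr A.mult_smult intro: A.mult_comm\<close>)
qed

section \<open>The span as a subalgebra of the series without constant term\<close>

context cring
begin

definition augmentation_ideal :: "(nat multiset \<Rightarrow> 'a) set" where
  "augmentation_ideal = {f \<in> carrier (power_series R). f {#} = \<zero>}"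

lemma power_series_mult_const_coeff:
  "(f \<otimes>\<^bsub>power_series R\<^esub> g) {#} = (\<Oplus>p\<in>{({#}, {#})}. f (fst p) \<otimes> g (snd p))"
proof -
  have "{p. fst p + snd p = ({#} :: nat multiset)} = {({#}, {#})}" by (auto simp: prod_eq_iff)
  then show ?thesis by (simp add: power_series_mult)
qed

lemma comm_rota_baxter_augmentation_ideal:
  "comm_rota_baxter R (power_series R\<lparr>carrier := augmentation_ideal\<rparr>) (shift_sum R)"
proof -
  interpret PS: algebra R "power_series R" by (rule power_series_algebra)
  have sub: "submodule augmentation_ideal R (power_series R)"
    by (rule PS.submoduleI') (auto simp: augmentation_ideal_def power_series_simps)
  interpret H: module R "power_series R\<lparr>carrier := augmentation_ideal\<rparr>"
    by (rule submodule.submodule_is_module[OF sub PS.module])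
  have "x \<otimes>\<^bsub>power_series R\<^esub> y \<in> augmentation_ideal"
    if "x \<in> augmentation_ideal" "y \<in> augmentation_ideal" for x y
    using that by (simp add: augmentation_ideal_def power_series_mult_closed power_series_mult_const_coeff)
  moreover have "shift_sum R x \<in> augmentation_ideal" if "x \<in> augmentation_ideal" for x
    using that by (simp add: augmentation_ideal_def shift_sum_closed shift_sum_0)
  moreover have "augmentation_ideal \<subseteq> carrier (power_series R)"
    by (auto simp: augmentation_ideal_def)
  ultimately show ?thesis
    by unfold_locales
      (auto simp: subset_iff PS.m_assoc PS.l_distr PS.smult_assoc2 rota_baxter_operator_def linear_map_def
        shift_sum_add shift_sum_smult shift_sum_rota_baxter augmentation_ideal_def intro: power_series_mult_comm)
qed

lemma module_power_series: "module R (power_series R)"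
  by (rule algebra.module[OF power_series_algebra])

lemma LWCQSym_bar_simps [simp]:
  "mult (LWCQSym_bar R) = mult (power_series R)"
  "add (LWCQSym_bar R) = add (power_series R)"
  "zero (LWCQSym_bar R) = zero (power_series R)"
  "smult (LWCQSym_bar R) = smult (power_series R)"
  by (simp_all add: LWCQSym_bar_def)

lemma carrier_LWCQSym_bar:
  "carrier (LWCQSym_bar R) = module_span R (power_series R) (M_bar R ` left_weak_compositions)"
  by (simp add: LWCQSym_bar_def)

lemma submodule_LWCQSym_bar: "submodule (carrier (LWCQSym_bar R)) R (power_series R)"
  unfolding carrier_LWCQSym_bar
  by (rule module.submodule_module_span[OF module_power_series]) (auto intro: M_bar_closed)

lemmas LWCQSym_bar_closed = module.submoduleE[OF module_power_series submodule_LWCQSym_bar]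

lemma module_LWCQSym_bar: "module R (LWCQSym_bar R)"
  using submodule.submodule_is_module[OF submodule_LWCQSym_bar module_power_series]
  by (simp add: LWCQSym_bar_def)

lemma M_bar_in_LWCQSym_bar:
  "\<alpha> \<in> left_weak_compositions \<Longrightarrow> M_bar R \<alpha> \<in> carrier (LWCQSym_bar R)"
  unfolding carrier_LWCQSym_bar using module.module_span_superset[OF module_power_series] by blast

lemma LWCQSym_bar_induct [consumes 1, case_names M_bar zero add smult]:
  assumes "f \<in> carrier (LWCQSym_bar R)"
    and "\<And>\<alpha>. \<alpha> \<in> left_weak_compositions \<Longrightarrow> Q (M_bar R \<alpha>)" and "Q \<zero>\<^bsub>power_series R\<^esub>"
    and "\<And>f g. f \<in> carrier (LWCQSym_bar R) \<Longrightarrow> g \<in> carrier (LWCQSym_bar R) \<Longrightarrow> Q f \<Longrightarrow> Q g \<Longrightarrow>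
      Q (f \<oplus>\<^bsub>power_series R\<^esub> g)"
    and "\<And>c f. c \<in> carrier R \<Longrightarrow> f \<in> carrier (LWCQSym_bar R) \<Longrightarrow> Q f \<Longrightarrow> Q (c \<odot>\<^bsub>power_series R\<^esub> f)"
  shows "Q f"
  using assms unfolding carrier_LWCQSym_bar
  by (intro module.module_span_induct[OF module_power_series, of "M_bar R ` left_weak_compositions" f Q])
    (auto intro: M_bar_closed)

lemma LWCQSym_bar_zero_closed: "\<zero>\<^bsub>power_series R\<^esub> \<in> carrier (LWCQSym_bar R)"
  using module.axioms(2)[OF module_LWCQSym_bar] abelian_groupE(2) by fastforce

lemma linear_map_eqI:
  assumes B: "module R B"
    and f: "linear_map R (LWCQSym_bar R) B f" and g: "linear_map R (LWCQSym_bar R) B g"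
    and eq: "\<And>\<alpha>. \<alpha> \<in> left_weak_compositions \<Longrightarrow> f (M_bar R \<alpha>) = g (M_bar R \<alpha>)"
    and x: "x \<in> carrier (LWCQSym_bar R)"
  shows "f x = g x"
  using x
proof (induction rule: LWCQSym_bar_induct)
  case zero
  show ?case
    using linear_map_zero[OF module_LWCQSym_bar B f] linear_map_zero[OF module_LWCQSym_bar B g] by simp
qed (use f g eq in \<open>auto simp: linear_map_def\<close>)

lemma LWCQSym_bar_augmentation_ideal: "carrier (LWCQSym_bar R) \<subseteq> augmentation_ideal"
proof
  fix f assume "f \<in> carrier (LWCQSym_bar R)"
  then have "f \<in> carrier (power_series R)" "f {#} = \<zero>"
    using LWCQSym_bar_closed(1)
    by (blast, induction rule: LWCQSym_bar_induct) (auto simp: M_bar_const_coeff power_series_simps)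
  then show "f \<in> augmentation_ideal" by (simp add: augmentation_ideal_def)
qed

lemma shift_sum_M_bar:
  assumes "\<alpha> \<in> left_weak_compositions"
  shows "shift_sum R (M_bar R \<alpha>) = M_bar R (0 # \<alpha>)"
proof -
  interpret PS: cring "power_series R" by (rule power_series_cring)
  show ?thesis using assms by (simp add: M_bar_Cons shift_sum_closed M_bar_closed flip: one_power_series)
qed

lemma shift_sum_LWCQSym_bar:
  assumes "f \<in> carrier (LWCQSym_bar R)"
  shows "shift_sum R f \<in> carrier (LWCQSym_bar R)"
  using assms
proof (induction rule: LWCQSym_bar_induct)
  case (M_bar \<alpha>)
  then show ?case
    unfolding shift_sum_M_bar[OF M_bar] by (intro M_bar_in_LWCQSym_bar) (simp add: left_weak_compositions_def)
next
  case zero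
  have "shift_sum R \<zero>\<^bsub>power_series R\<^esub> = \<zero>\<^bsub>power_series R\<^esub>"
    using shift_sum_smult[of \<zero> "\<zero>\<^bsub>power_series R\<^esub>"] shift_sum_closed[of "\<zero>\<^bsub>power_series R\<^esub>"]
    by (simp add: power_series_def)
  then show ?case by (simp add: LWCQSym_bar_zero_closed)
qed (use LWCQSym_bar_closed in \<open>auto simp: shift_sum_add shift_sum_smult subset_iff\<close>)

lemma var_0_mult_M_bar:
  "var R 0 \<otimes>\<^bsub>power_series R\<^esub> M_bar R (b # \<beta>) = M_bar R (Suc b # \<beta>)"
proof -
  interpret PS: cring "power_series R" by (rule power_series_cring)
  show ?thesis
    unfolding M_bar_def var_pow list.sel unfolding var_eq_monomial
    by (simp add: monomial_mult_monomial monomial_closed M_qsym_closed flip: PS.m_assoc)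
qed

lemma var_0_mult_LWCQSym_bar:
  assumes "f \<in> carrier (LWCQSym_bar R)"
  shows "var R 0 \<otimes>\<^bsub>power_series R\<^esub> f \<in> carrier (LWCQSym_bar R)"
proof -
  interpret PS: algebra R "power_series R" by (rule power_series_algebra)
  have v: "var R 0 \<in> carrier (power_series R)" by (simp add: var_eq_monomial monomial_closed)
  have sm: "var R 0 \<otimes>\<^bsub>power_series R\<^esub> (c \<odot>\<^bsub>power_series R\<^esub> f) =
      c \<odot>\<^bsub>power_series R\<^esub> (var R 0 \<otimes>\<^bsub>power_series R\<^esub> f)"
    if "c \<in> carrier R" "f \<in> carrier (power_series R)" for c f
    using that v by (simp add: power_series_mult_comm[of "var R 0"] PS.smult_assoc2)
  show ?thesis
    using assms
  proof (induction rule: LWCQSym_bar_induct)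
    case (M_bar \<alpha>)
    then obtain b \<beta> where "\<alpha> = b # \<beta>" by (cases \<alpha>) (auto simp: left_weak_compositions_def)
    with M_bar show ?case
      by (auto simp: var_0_mult_M_bar left_weak_compositions_Cons intro!: M_bar_in_LWCQSym_bar)
  qed (use LWCQSym_bar_closed LWCQSym_bar_zero_closed v in \<open>auto simp: PS.r_distr sm subset_iff\<close>)
qed

lemma funpow_var_0_mult_LWCQSym_bar:
  assumes "f \<in> carrier (LWCQSym_bar R)"
  shows "((\<lambda>y. var R 0 \<otimes>\<^bsub>power_series R\<^esub> y) ^^ n) f \<in> carrier (LWCQSym_bar R)"
  using assms by (induction n) (auto simp: var_0_mult_LWCQSym_bar)

lemma M_bar_single_mult:
  assumes "a > 0" "\<beta> \<in> left_weak_compositions"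
  shows "M_bar R [a] \<otimes>\<^bsub>power_series R\<^esub> M_bar R \<beta> = ((\<lambda>y. var R 0 \<otimes>\<^bsub>power_series R\<^esub> y) ^^ a) (M_bar R \<beta>)"
  using assms by (simp add: M_bar_single monomial_0_power_mult M_bar_closed)

text \<open>The product formula for words, taken in the ideal of series without constant term.
  Closure of the span under multiplication is not yet available and is deduced from it.\<close>

lemma M_bar_Cons_mult:
  assumes \<alpha>: "\<alpha> \<in> left_weak_compositions" and \<beta>: "\<beta> \<in> left_weak_compositions"
  shows "M_bar R (a # \<alpha>) \<otimes>\<^bsub>power_series R\<^esub> M_bar R (b # \<beta>) =
    ((\<lambda>y. var R 0 \<otimes>\<^bsub>power_series R\<^esub> y) ^^ (a + b))
      (shift_sum R (M_bar R \<alpha> \<otimes>\<^bsub>power_series R\<^esub> M_bar R (0 # \<beta>)) \<oplus>\<^bsub>power_series R\<^esub>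
       shift_sum R (M_bar R (0 # \<alpha>) \<otimes>\<^bsub>power_series R\<^esub> M_bar R \<beta>) \<oplus>\<^bsub>power_series R\<^esub>
       shift_sum R (M_bar R \<alpha> \<otimes>\<^bsub>power_series R\<^esub> M_bar R \<beta>))"
proof -
  let ?A = "power_series R\<lparr>carrier := augmentation_ideal\<rparr>"
  interpret A: comm_rota_baxter R ?A "shift_sum R" by (rule comm_rota_baxter_augmentation_ideal)
  have w: "M_bar R \<gamma> = rb_word ?A (shift_sum R) (var R 0) \<gamma>" if "\<gamma> \<in> left_weak_compositions" for \<gamma>
    unfolding M_bar_1[symmetric] using that by (rule M_bar_eq_rb_word) simp_all
  have x: "var R 0 \<in> carrier ?A"
    by (simp add: augmentation_ideal_def var_eq_monomial monomial_closed) (simp add: monomial_def)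
  have l: "a # \<alpha> \<in> left_weak_compositions" "b # \<beta> \<in> left_weak_compositions"
    "0 # \<alpha> \<in> left_weak_compositions" "0 # \<beta> \<in> left_weak_compositions"
    using \<alpha> \<beta> by (auto simp: left_weak_compositions_def)
  show ?thesis
    using A.rb_word_Cons_mult[OF \<alpha> \<beta> x, of a b] unfolding w[OF \<alpha>] w[OF \<beta>] w[OF l(1)] w[OF l(2)] w[OF l(3)] w[OF l(4)]
    by simp
qed

text \<open>The product formula reduces to shorter products, and the span is stable under the
  operations around them: addition, \<open>shift_sum\<close> and multiplication by x_0.\<close>

lemma M_bar_mult_closed:
  assumes "\<alpha> \<in> left_weak_compositions" "\<beta> \<in> left_weak_compositions"
  shows "M_bar R \<alpha> \<otimes>\<^bsub>power_series R\<^esub> M_bar R \<beta> \<in> carrier (LWCQSym_bar R)"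
  using assms
proof (induction rule: product_induct)
  case (single a \<beta>)
  then show ?case by (simp add: M_bar_single_mult funpow_var_0_mult_LWCQSym_bar M_bar_in_LWCQSym_bar)
next
  case (comm \<alpha> \<beta>)
  then show ?case by (simp add: power_series_mult_comm[of "M_bar R \<beta>"] M_bar_closed)
next
  case (Cons a b \<alpha> \<beta>)
  then show ?case
    unfolding M_bar_Cons_mult[OF Cons(1,2)]
    by (intro funpow_var_0_mult_LWCQSym_bar LWCQSym_bar_closed(5) shift_sum_LWCQSym_bar)
qed

lemma LWCQSym_bar_mult_closed:
  assumes f: "f \<in> carrier (LWCQSym_bar R)" and g: "g \<in> carrier (LWCQSym_bar R)"
  shows "f \<otimes>\<^bsub>power_series R\<^esub> g \<in> carrier (LWCQSym_bar R)"
proof -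
  interpret PS: algebra R "power_series R" by (rule power_series_algebra)
  have sm: "h \<otimes>\<^bsub>power_series R\<^esub> (c \<odot>\<^bsub>power_series R\<^esub> f) =
      c \<odot>\<^bsub>power_series R\<^esub> (h \<otimes>\<^bsub>power_series R\<^esub> f)"
    if "c \<in> carrier R" "f \<in> carrier (power_series R)" "h \<in> carrier (power_series R)" for c f h
    using that by (simp add: power_series_mult_comm[of h] PS.smult_assoc2)
  note V = LWCQSym_bar_closed(1)[THEN subsetD] LWCQSym_bar_closed(4,5) LWCQSym_bar_zero_closed
  have "M_bar R \<alpha> \<otimes>\<^bsub>power_series R\<^esub> g \<in> carrier (LWCQSym_bar R)" if "\<alpha> \<in> left_weak_compositions" for \<alpha>
    using g by (induction rule: LWCQSym_bar_induct)
      (use that V in \<open>auto simp: M_bar_mult_closed PS.r_distr sm M_bar_closed\<close>)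
  with f show ?thesis
    by (induction rule: LWCQSym_bar_induct)
      (use g V in \<open>auto simp: PS.l_distr PS.smult_assoc2\<close>)
qed

end

section \<open>The universal property\<close>

context cring
begin

lemma finite_coeff_bar_support:
  assumes "f \<in> carrier (LWCQSym_bar R)"
  shows "finite {\<alpha> \<in> left_weak_compositions. coeff_bar R \<alpha> f \<noteq> \<zero>}"
  using assms
proof (induction rule: LWCQSym_bar_induct)
  case (M_bar \<beta>)
  then show ?case
    by (intro finite_subset[OF _ finite.insertI[OF finite.emptyI, of \<beta>]]) (auto simp: coeff_bar_M_bar split: if_splits)
next
  case zero
  have "\<zero>\<^bsub>power_series R\<^esub> = (\<lambda>m. \<zero>)" by (simp add: power_series_def)
  then show ?case by (simp add: coeff_bar_zero)
next
  case (add f g)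
  then have "f \<in> carrier (power_series R)" "g \<in> carrier (power_series R)"
    using LWCQSym_bar_closed(1) by auto
  then have "{\<alpha> \<in> left_weak_compositions. coeff_bar R \<alpha> (f \<oplus>\<^bsub>power_series R\<^esub> g) \<noteq> \<zero>} \<subseteq>
      {\<alpha> \<in> left_weak_compositions. coeff_bar R \<alpha> f \<noteq> \<zero>} \<union> {\<alpha> \<in> left_weak_compositions. coeff_bar R \<alpha> g \<noteq> \<zero>}"
    by (auto simp: coeff_bar_add)
  then show ?case using add by (meson finite_Un finite_subset)
next
  case (smult c f)
  then have "f \<in> carrier (power_series R)" using LWCQSym_bar_closed(1) by auto
  then have "{\<alpha> \<in> left_weak_compositions. coeff_bar R \<alpha> (c \<odot>\<^bsub>power_series R\<^esub> f) \<noteq> \<zero>} \<subseteq>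
      {\<alpha> \<in> left_weak_compositions. coeff_bar R \<alpha> f \<noteq> \<zero>}"
    using smult(1) by (auto simp: coeff_bar_smult)
  then show ?case using smult by (meson finite_subset)
qed

text \<open>The span is a free module on the words: the dual functionals provide coordinates, only
  finitely many of them nonzero on an element of the span, so values on words can be prescribed at
  will.\<close>

lemma LWCQSym_bar_extend:
  assumes B: "module R B" and H: "\<And>\<alpha>. \<alpha> \<in> left_weak_compositions \<Longrightarrow> H \<alpha> \<in> carrier B"
  obtains h where "linear_map R (LWCQSym_bar R) B h"
    "\<And>\<alpha>. \<alpha> \<in> left_weak_compositions \<Longrightarrow> h (M_bar R \<alpha>) = H \<alpha>"
proof -
  interpret B: module R B by (rule B)
  define supp where "supp f = {\<alpha> \<in> left_weak_compositions. coeff_bar R \<alpha> f \<noteq> \<zero>}" for f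
  define h where "h f = (\<Oplus>\<^bsub>B\<^esub>\<alpha>\<in>supp f. coeff_bar R \<alpha> f \<odot>\<^bsub>B\<^esub> H \<alpha>)" for f
  have PS: "f \<in> carrier (power_series R)" if "f \<in> carrier (LWCQSym_bar R)" for f
    using that LWCQSym_bar_closed(1) by auto
  have term_closed: "coeff_bar R \<alpha> f \<odot>\<^bsub>B\<^esub> H \<alpha> \<in> carrier B"
    if "f \<in> carrier (power_series R)" "\<alpha> \<in> left_weak_compositions" for f \<alpha>
    using that by (simp add: coeff_bar_closed H)
  have fin: "finite (supp f)" if "f \<in> carrier (LWCQSym_bar R)" for f
    unfolding supp_def using that by (rule finite_coeff_bar_support)
  \<comment> \<open>Any finite set of words containing the support may replace it, so that
    \<open>f\<close>, \<open>g\<close> and their sum can be evaluated over one common index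
    set.\<close>
  have h_eq: "h f = (\<Oplus>\<^bsub>B\<^esub>\<alpha>\<in>S. coeff_bar R \<alpha> f \<odot>\<^bsub>B\<^esub> H \<alpha>)"
    if f: "f \<in> carrier (LWCQSym_bar R)" and S: "finite S" "supp f \<subseteq> S" "S \<subseteq> left_weak_compositions" for f S
    unfolding h_def
    by (rule B.M.add.finprod_mono_neutral_cong_left)
      (use S term_closed[OF PS[OF f]] H in \<open>auto simp: supp_def\<close>)
  have h_closed: "h f \<in> carrier B" if "f \<in> carrier (LWCQSym_bar R)" for f
    unfolding h_def using term_closed[OF PS[OF that]] by (intro B.M.finsum_closed) (auto simp: supp_def)
  have "h (f \<oplus>\<^bsub>power_series R\<^esub> g) = h f \<oplus>\<^bsub>B\<^esub> h g"
    if f: "f \<in> carrier (LWCQSym_bar R)" and g: "g \<in> carrier (LWCQSym_bar R)" for f g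
  proof -
    let ?S = "supp f \<union> supp g"
    have S: "?S \<subseteq> left_weak_compositions" by (auto simp: supp_def)
    have "h (f \<oplus>\<^bsub>power_series R\<^esub> g) =
        (\<Oplus>\<^bsub>B\<^esub>\<alpha>\<in>?S. coeff_bar R \<alpha> (f \<oplus>\<^bsub>power_series R\<^esub> g) \<odot>\<^bsub>B\<^esub> H \<alpha>)"
      using f g PS fin S by (intro h_eq LWCQSym_bar_closed(5)) (auto simp: supp_def coeff_bar_add)
    also have "\<dots> = (\<Oplus>\<^bsub>B\<^esub>\<alpha>\<in>?S. coeff_bar R \<alpha> f \<odot>\<^bsub>B\<^esub> H \<alpha> \<oplus>\<^bsub>B\<^esub> coeff_bar R \<alpha> g \<odot>\<^bsub>B\<^esub> H \<alpha>)"
      using S f g PS term_closed H by (intro B.M.finsum_cong')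
        (auto simp: coeff_bar_add coeff_bar_closed subset_iff intro!: B.smult_l_distr)
    also have "\<dots> = (\<Oplus>\<^bsub>B\<^esub>\<alpha>\<in>?S. coeff_bar R \<alpha> f \<odot>\<^bsub>B\<^esub> H \<alpha>) \<oplus>\<^bsub>B\<^esub> (\<Oplus>\<^bsub>B\<^esub>\<alpha>\<in>?S. coeff_bar R \<alpha> g \<odot>\<^bsub>B\<^esub> H \<alpha>)"
      using S f g PS term_closed by (intro B.M.finsum_addf) (auto simp: subset_iff)
    also have "\<dots> = h f \<oplus>\<^bsub>B\<^esub> h g"
      using S f g fin by (subst (1 2) h_eq[of _ ?S]) auto
    finally show ?thesis .
  qed
  moreover have "h (c \<odot>\<^bsub>power_series R\<^esub> f) = c \<odot>\<^bsub>B\<^esub> h f"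
    if c: "c \<in> carrier R" and f: "f \<in> carrier (LWCQSym_bar R)" for c f
  proof -
    have S: "supp f \<subseteq> left_weak_compositions" by (auto simp: supp_def)
    have "h (c \<odot>\<^bsub>power_series R\<^esub> f) = (\<Oplus>\<^bsub>B\<^esub>\<alpha>\<in>supp f. coeff_bar R \<alpha> (c \<odot>\<^bsub>power_series R\<^esub> f) \<odot>\<^bsub>B\<^esub> H \<alpha>)"
      using f c PS fin S by (intro h_eq LWCQSym_bar_closed(4)) (auto simp: supp_def coeff_bar_smult)
    also have "\<dots> = (\<Oplus>\<^bsub>B\<^esub>\<alpha>\<in>supp f. c \<odot>\<^bsub>B\<^esub> (coeff_bar R \<alpha> f \<odot>\<^bsub>B\<^esub> H \<alpha>))"
      using S f c PS term_closed H by (intro B.M.finsum_cong')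
        (auto simp: coeff_bar_smult coeff_bar_closed subset_iff intro!: B.smult_assoc1)
    also have "\<dots> = c \<odot>\<^bsub>B\<^esub> h f"
      unfolding h_def using S f c PS term_closed fin by (intro B.finsum_smult_ldistr[symmetric]) (auto simp: subset_iff)
    finally show ?thesis .
  qed
  ultimately have "linear_map R (LWCQSym_bar R) B h"
    using h_closed by (simp add: linear_map_def)
  moreover have "h (M_bar R \<beta>) = H \<beta>" if \<beta>: "\<beta> \<in> left_weak_compositions" for \<beta>
  proof -
    have "h (M_bar R \<beta>) = (\<Oplus>\<^bsub>B\<^esub>\<alpha>\<in>{\<beta>}. coeff_bar R \<alpha> (M_bar R \<beta>) \<odot>\<^bsub>B\<^esub> H \<alpha>)"
      using \<beta> by (intro h_eq M_bar_in_LWCQSym_bar) (auto simp: supp_def coeff_bar_M_bar split: if_splits)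
    then show ?thesis using \<beta> by (simp add: coeff_bar_M_bar H)
  qed
  ultimately show ?thesis by (rule that)
qed

section \<open>The Rota-Baxter operator on the span\<close>

lemma comm_rota_baxter_LWCQSym_bar:
  assumes "\<And>f. f \<in> carrier (LWCQSym_bar R) \<Longrightarrow> P f = shift_sum R f"
  shows "comm_rota_baxter R (LWCQSym_bar R) P"
proof -
  let ?A = "power_series R\<lparr>carrier := augmentation_ideal\<rparr>"
  interpret A: comm_rota_baxter R ?A "shift_sum R" by (rule comm_rota_baxter_augmentation_ideal)
  have eq: "LWCQSym_bar R = ?A\<lparr>carrier := carrier (LWCQSym_bar R)\<rparr>"
    by (simp add: LWCQSym_bar_def)
  have "module R (?A\<lparr>carrier := carrier (LWCQSym_bar R)\<rparr>)"
    using module_LWCQSym_bar by (simp flip: eq)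
  then have "submodule (carrier (LWCQSym_bar R)) R ?A"
    using A.module_incl_imp_submodule LWCQSym_bar_augmentation_ideal by simp
  from comm_rota_baxter_subalgebra[OF A.comm_rota_baxter_axioms this, of P]
  show ?thesis
    using assms by (simp add: LWCQSym_bar_mult_closed shift_sum_LWCQSym_bar flip: eq)
qed

text \<open>Existence comes from \<open>shift_sum\<close>, which is linear on all series and has the
  prescribed values on words; uniqueness holds because the words span. The restriction accounts for
  the extensionality in \<open>is_P_Q\<close>.\<close>

lemma is_P_Q_iff: "is_P_Q R P \<longleftrightarrow> P = restrict (shift_sum R) (carrier (LWCQSym_bar R))"
proof -
  let ?V = "carrier (LWCQSym_bar R)"
  let ?P = "restrict (shift_sum R) ?V"
  interpret V: comm_rota_baxter R "LWCQSym_bar R" ?P by (rule comm_rota_baxter_LWCQSym_bar) simp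
  have lin: "linear_map R (LWCQSym_bar R) (LWCQSym_bar R) ?P"
    using V.rota_baxter_operator by (simp add: rota_baxter_operator_def)
  have "is_P_Q R ?P"
    using lin by (simp add: is_P_Q_def shift_sum_M_bar M_bar_in_LWCQSym_bar)
  moreover have "P = ?P" if P: "is_P_Q R P"
  proof (rule extensionalityI)
    show "P x = ?P x" if "x \<in> ?V" for x
      using module_LWCQSym_bar _ lin _ that
    proof (rule linear_map_eqI)
      show "linear_map R (LWCQSym_bar R) (LWCQSym_bar R) P" using P by (simp add: is_P_Q_def)
      show "P (M_bar R \<alpha>) = ?P (M_bar R \<alpha>)" if "\<alpha> \<in> left_weak_compositions" for \<alpha>
        using P that by (simp add: is_P_Q_def shift_sum_M_bar M_bar_in_LWCQSym_bar)
    qed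
  qed (use P in \<open>auto simp: is_P_Q_def\<close>)
  ultimately show ?thesis by blast
qed

lemma P_Q_eq: "P_Q R = restrict (shift_sum R) (carrier (LWCQSym_bar R))"
  by (simp add: P_Q_def is_P_Q_iff)

lemma comm_rota_baxter_P_Q: "comm_rota_baxter R (LWCQSym_bar R) (P_Q R)"
  by (rule comm_rota_baxter_LWCQSym_bar) (simp add: P_Q_eq)

lemma M_bar_eq_rb_word_P_Q:
  assumes "\<alpha> \<in> left_weak_compositions"
  shows "M_bar R \<alpha> = rb_word (LWCQSym_bar R) (P_Q R) (M_bar R [1]) \<alpha>"
  using assms by (rule M_bar_eq_rb_word) (simp_all add: P_Q_eq M_bar_in_LWCQSym_bar)

text \<open>The linear map sending words in x_0 to the same words in \<open>r\<close>. It is first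
  shown to respect multiplication by x_0 and the operator; the recursion for products of words then
  has the same shape on both sides and yields multiplicativity.\<close>

lemma LWCQSym_bar_hom_exists:
  assumes "comm_rota_baxter R B Q" and r: "r \<in> carrier B"
  shows "\<exists>h. rota_baxter_hom R (LWCQSym_bar R) (P_Q R) B Q h \<and> h (M_bar R [1]) = r"
proof -
  interpret B: comm_rota_baxter R B Q by fact
  interpret PS: algebra R "power_series R" by (rule power_series_algebra)
  let ?V = "carrier (LWCQSym_bar R)" and ?x = "var R 0"
  note V = LWCQSym_bar_closed(1)[THEN subsetD] LWCQSym_bar_closed(4,5) LWCQSym_bar_mult_closed
    shift_sum_LWCQSym_bar M_bar_in_LWCQSym_bar var_0_mult_LWCQSym_bar funpow_var_0_mult_LWCQSym_bar
  have x: "?x \<in> carrier (power_series R)" by (simp add: var_eq_monomial monomial_closed)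
  have PS_smult: "f \<otimes>\<^bsub>power_series R\<^esub> (c \<odot>\<^bsub>power_series R\<^esub> g) =
      c \<odot>\<^bsub>power_series R\<^esub> (f \<otimes>\<^bsub>power_series R\<^esub> g)"
    if "c \<in> carrier R" "f \<in> carrier (power_series R)" "g \<in> carrier (power_series R)" for c f g
    using that by (simp add: power_series_mult_comm[of f] PS.smult_assoc2)
  have B_smult: "y \<otimes>\<^bsub>B\<^esub> (c \<odot>\<^bsub>B\<^esub> z) = c \<odot>\<^bsub>B\<^esub> (y \<otimes>\<^bsub>B\<^esub> z)"
    if "c \<in> carrier R" "y \<in> carrier B" "z \<in> carrier B" for c y z
    using that by (simp add: B.mult_comm[of y] B.mult_smult)
  have B_distr: "y \<otimes>\<^bsub>B\<^esub> (z \<oplus>\<^bsub>B\<^esub> w) = y \<otimes>\<^bsub>B\<^esub> z \<oplus>\<^bsub>B\<^esub> y \<otimes>\<^bsub>B\<^esub> w"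
    if "y \<in> carrier B" "z \<in> carrier B" "w \<in> carrier B" for y z w
    using that by (simp add: B.mult_comm[of y] B.mult_add_distr)
  have B_zero: "y \<otimes>\<^bsub>B\<^esub> \<zero>\<^bsub>B\<^esub> = \<zero>\<^bsub>B\<^esub>" if "y \<in> carrier B" for y
    using B_smult[of \<zero> y y] that by (simp add: B.mult_closed)
  have Q_add: "Q (y \<oplus>\<^bsub>B\<^esub> z) = Q y \<oplus>\<^bsub>B\<^esub> Q z" if "y \<in> carrier B" "z \<in> carrier B" for y z
    using B.rota_baxter_operator that by (auto simp: rota_baxter_operator_def linear_map_def)
  have Q_smult: "Q (c \<odot>\<^bsub>B\<^esub> y) = c \<odot>\<^bsub>B\<^esub> Q y" if "c \<in> carrier R" "y \<in> carrier B" for c y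
    using B.rota_baxter_operator that by (auto simp: rota_baxter_operator_def linear_map_def)
  define w where "w = rb_word B Q r"
  have w_closed: "w \<alpha> \<in> carrier B" for \<alpha>
    unfolding w_def using r by (rule B.rb_word_closed)
  obtain h where lin: "linear_map R (LWCQSym_bar R) B h"
    and h_M: "\<And>\<alpha>. \<alpha> \<in> left_weak_compositions \<Longrightarrow> h (M_bar R \<alpha>) = w \<alpha>"
    using LWCQSym_bar_extend[OF B.module_axioms, of w] w_closed by blast
  have h_closed: "h f \<in> carrier B" if "f \<in> ?V" for f
    using lin that by (auto simp: linear_map_def)
  have h_add: "h (f \<oplus>\<^bsub>power_series R\<^esub> g) = h f \<oplus>\<^bsub>B\<^esub> h g" if "f \<in> ?V" "g \<in> ?V" for f g
    using lin that by (auto simp: linear_map_def)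
  have h_smult: "h (c \<odot>\<^bsub>power_series R\<^esub> f) = c \<odot>\<^bsub>B\<^esub> h f" if "c \<in> carrier R" "f \<in> ?V" for c f
    using lin that by (auto simp: linear_map_def)
  have h_zero: "h \<zero>\<^bsub>power_series R\<^esub> = \<zero>\<^bsub>B\<^esub>"
    using linear_map_zero[OF module_LWCQSym_bar B.module_axioms lin] by simp
  \<comment> \<open>Multiplication by x_0 raises the first letter of a word by one, and
    multiplication by \<open>r\<close> does the same in \<open>B\<close>.\<close>
  have h_x: "h (?x \<otimes>\<^bsub>power_series R\<^esub> f) = r \<otimes>\<^bsub>B\<^esub> h f" if "f \<in> ?V" for f
    using that
  proof (induction rule: LWCQSym_bar_induct)
    case (M_bar \<alpha>)
    then obtain b \<beta> where \<alpha>: "\<alpha> = b # \<beta>" by (cases \<alpha>) (auto simp: left_weak_compositions_def)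
    have "Suc b # \<beta> \<in> left_weak_compositions" using M_bar by (simp add: \<alpha> left_weak_compositions_Cons)
    moreover have "w (Suc b # \<beta>) = r \<otimes>\<^bsub>B\<^esub> w (b # \<beta>)"
    proof (cases "\<beta> = []")
      case True
      \<comment> \<open>Here \<open>b\<close> is positive because \<open>[0]\<close> is no left weak
        composition; at \<open>b = 0\<close> the truncated exponent \<open>b - 1\<close> would break
        the identity.\<close>
      then obtain n where "b = Suc n" using M_bar by (cases b) (auto simp: \<alpha> left_weak_compositions_Cons)
      with True show ?thesis by (simp add: w_def)
    next
      case False
      then show ?thesis using M_bar by (simp add: \<alpha> left_weak_compositions_Cons w_def rb_word_Cons)
    qed
    ultimately show ?case using M_bar by (simp add: \<alpha> var_0_mult_M_bar h_M)
  next
    case zero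
    then show ?case using x by (simp add: h_zero B_zero r)
  next
    case (add f g)
    then show ?case using V x r by (simp add: PS.r_distr h_add h_closed B_distr)
  next
    case (smult c f)
    then show ?case using V x r by (simp add: PS_smult h_smult h_closed B_smult)
  qed
  have h_funpow: "h (((\<lambda>y. ?x \<otimes>\<^bsub>power_series R\<^esub> y) ^^ n) f) = ((\<lambda>y. r \<otimes>\<^bsub>B\<^esub> y) ^^ n) (h f)" if "f \<in> ?V" for f n
    using that by (induction n) (simp_all add: h_x V)
  have h_P: "h (shift_sum R f) = Q (h f)" if "f \<in> ?V" for f
    using that
  proof (induction rule: LWCQSym_bar_induct)
    case (M_bar \<alpha>)
    then have "0 # \<alpha> \<in> left_weak_compositions" by (simp add: left_weak_compositions_def)
    then show ?case using M_bar by (simp add: shift_sum_M_bar h_M w_def rb_word_Cons)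
  next
    case zero
    have "shift_sum R \<zero>\<^bsub>power_series R\<^esub> = \<zero>\<^bsub>power_series R\<^esub>"
      using shift_sum_smult[of \<zero> "\<zero>\<^bsub>power_series R\<^esub>"] shift_sum_closed[of "\<zero>\<^bsub>power_series R\<^esub>"] by simp
    moreover have "Q \<zero>\<^bsub>B\<^esub> = \<zero>\<^bsub>B\<^esub>"
      using Q_smult[of \<zero> "\<zero>\<^bsub>B\<^esub>"] by (simp add: B.P_closed)
    ultimately show ?case by (simp add: h_zero)
  next
    case (add f g)
    then show ?case using V by (simp add: shift_sum_add h_add h_closed Q_add)
  next
    case (smult c f)
    then show ?case using V by (simp add: shift_sum_smult h_smult h_closed Q_smult)
  qed
  \<comment> \<open>\<open>M_bar_Cons_mult\<close> and \<open>rb_word_Cons_mult\<close> expand the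
    two sides alike, and \<open>h\<close> passes through every operation of the expansion.\<close>
  have h_M_mult: "h (M_bar R \<alpha> \<otimes>\<^bsub>power_series R\<^esub> M_bar R \<beta>) = w \<alpha> \<otimes>\<^bsub>B\<^esub> w \<beta>"
    if "\<alpha> \<in> left_weak_compositions" "\<beta> \<in> left_weak_compositions" for \<alpha> \<beta>
    using that
  proof (induction rule: product_induct)
    case (single a \<beta>)
    have "w [a] \<otimes>\<^bsub>B\<^esub> w \<beta> = ((\<lambda>y. r \<otimes>\<^bsub>B\<^esub> y) ^^ a) (w \<beta>)"
      unfolding w_def by (rule B.rb_word_single_mult[OF single(1) r B.rb_word_closed[OF r]])
    then show ?case using single by (simp add: M_bar_single_mult h_funpow V h_M)
  next
    case (comm \<alpha> \<beta>)
    then show ?case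
      by (simp add: power_series_mult_comm[of "M_bar R \<beta>"] M_bar_closed B.mult_comm[of "w \<beta>"] w_closed)
  next
    case (Cons a b \<alpha> \<beta>)
    have l: "0 # \<alpha> \<in> left_weak_compositions" "0 # \<beta> \<in> left_weak_compositions"
      using Cons by (auto simp: left_weak_compositions_def)
    have "w (a # \<alpha>) \<otimes>\<^bsub>B\<^esub> w (b # \<beta>) = ((\<lambda>y. r \<otimes>\<^bsub>B\<^esub> y) ^^ (a + b))
      (Q (w \<alpha> \<otimes>\<^bsub>B\<^esub> w (0 # \<beta>)) \<oplus>\<^bsub>B\<^esub> Q (w (0 # \<alpha>) \<otimes>\<^bsub>B\<^esub> w \<beta>) \<oplus>\<^bsub>B\<^esub> Q (w \<alpha> \<otimes>\<^bsub>B\<^esub> w \<beta>))"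
      unfolding w_def by (rule B.rb_word_Cons_mult[OF Cons(1,2) r])
    moreover note prods = M_bar_mult_closed[OF Cons(1) l(2)] M_bar_mult_closed[OF l(1) Cons(2)]
      M_bar_mult_closed[OF Cons(1,2)]
    ultimately show ?case
      unfolding M_bar_Cons_mult[OF Cons(1,2)]
      by (simp add: h_funpow h_add h_P V Cons.IH)
  qed
  have h_mult: "h (f \<otimes>\<^bsub>power_series R\<^esub> g) = h f \<otimes>\<^bsub>B\<^esub> h g" if f: "f \<in> ?V" and g: "g \<in> ?V" for f g
  proof -
    have M: "h (M_bar R \<alpha> \<otimes>\<^bsub>power_series R\<^esub> g) = w \<alpha> \<otimes>\<^bsub>B\<^esub> h g" if \<alpha>: "\<alpha> \<in> left_weak_compositions" for \<alpha>
      using g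
    proof (induction rule: LWCQSym_bar_induct)
      case (M_bar \<beta>)
      then show ?case using \<alpha> by (simp add: h_M_mult h_M)
    next
      case zero
      show ?case by (simp add: M_bar_closed h_zero B_zero w_closed)
    next
      case (add f g)
      then show ?case using V \<alpha> by (simp add: PS.r_distr h_add h_closed B_distr w_closed M_bar_closed)
    next
      case (smult c f)
      then show ?case using V \<alpha> by (simp add: PS_smult h_smult h_closed B_smult w_closed M_bar_closed)
    qed
    show ?thesis
      using f
    proof (induction rule: LWCQSym_bar_induct)
      case (M_bar \<alpha>)
      then show ?case by (simp add: M h_M)
    next
      case zero
      show ?case using g V by (simp add: h_zero B.mult_comm[of "\<zero>\<^bsub>B\<^esub>"] B_zero h_closed)
    next
      case (add f f')
      then show ?case using V g by (simp add: PS.l_distr h_add h_closed B.mult_add_distr)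
    next
      case (smult c f)
      then show ?case using V g by (simp add: PS.smult_assoc2 h_smult h_closed B.mult_smult)
    qed
  qed
  have "[1] \<in> left_weak_compositions" by (simp add: left_weak_compositions_def)
  then have "h (M_bar R [1]) = r" using h_M[of "[1]"] by (simp add: w_def)
  then show ?thesis
    using lin h_mult h_P by (auto simp: rota_baxter_hom_def P_Q_eq)
qed

text \<open>Uniqueness is asked among extensional maps, so a homomorphism has to be cut down to the
  carrier; closure of the carrier under all operations keeps it a homomorphism.\<close>

lemma rota_baxter_hom_restrict:
  assumes "comm_rota_baxter R A P" "rota_baxter_hom R A P B Q h"
  shows "rota_baxter_hom R A P B Q (restrict h (carrier A))"
proof -
  interpret A: comm_rota_baxter R A P by fact
  show ?thesis
    using assms(2) by (auto simp: rota_baxter_hom_def linear_map_def A.mult_closed A.P_closed)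
qed

lemma free_LWCQSym_bar:
  "free_comm_rota_baxter_algebra TYPE('r) R (LWCQSym_bar R) (P_Q R) (M_bar R [1])"
  unfolding free_comm_rota_baxter_algebra_def comm_rota_baxter_algebra_iff
proof (intro conjI allI impI; (elim conjE)?)
  let ?V = "carrier (LWCQSym_bar R)"
  show V: "comm_rota_baxter R (LWCQSym_bar R) (P_Q R)" by (rule comm_rota_baxter_P_Q)
  show x: "M_bar R [1] \<in> ?V"
    by (rule M_bar_in_LWCQSym_bar) (simp add: left_weak_compositions_def)
  fix B :: "('a, 'r) module" and Q r
  assume B: "comm_rota_baxter R B Q" and r: "r \<in> carrier B"
  interpret B: comm_rota_baxter R B Q by (rule B)
  obtain h where h: "rota_baxter_hom R (LWCQSym_bar R) (P_Q R) B Q h" "h (M_bar R [1]) = r"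
    using LWCQSym_bar_hom_exists[OF B r] by blast
  show "\<exists>!h. h \<in> extensional ?V \<and> rota_baxter_hom R (LWCQSym_bar R) (P_Q R) B Q h \<and> h (M_bar R [1]) = r"
  proof (rule ex1I[of _ "restrict h ?V"])
    show "restrict h ?V \<in> extensional ?V \<and>
        rota_baxter_hom R (LWCQSym_bar R) (P_Q R) B Q (restrict h ?V) \<and> restrict h ?V (M_bar R [1]) = r"
      using rota_baxter_hom_restrict[OF V h(1)] h(2) x by simp
    fix g assume g: "g \<in> extensional ?V \<and> rota_baxter_hom R (LWCQSym_bar R) (P_Q R) B Q g \<and> g (M_bar R [1]) = r"
    \<comment> \<open>The words in the generator span, so a homomorphism is determined by its value
      at the generator.\<close>
    have M: "f (M_bar R \<alpha>) = rb_word B Q r \<alpha>"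
      if "rota_baxter_hom R (LWCQSym_bar R) (P_Q R) B Q f" "f (M_bar R [1]) = r" "\<alpha> \<in> left_weak_compositions" for f \<alpha>
      using comm_rota_baxter.hom_rb_word[OF V that(1) x] M_bar_eq_rb_word_P_Q[OF that(3)] that(2) by metis
    show "g = restrict h ?V"
    proof (rule extensionalityI)
      show "g f = restrict h ?V f" if f: "f \<in> ?V" for f
      proof -
        have "g (M_bar R \<alpha>) = h (M_bar R \<alpha>)" if "\<alpha> \<in> left_weak_compositions" for \<alpha>
          using M[OF _ _ that] g h by metis
        then have "g f = h f"
          using linear_map_eqI[OF B.module_axioms _ _ _ f] g h(1) by (simp add: rota_baxter_hom_def)
        then show ?thesis using f by simp
      qed
    qed (use g in auto)
  qed
qed

end

theorem theorem3p9:
  fixes k :: "('k, 'm) ring_scheme"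
  assumes "cring k"
  shows
    "(\<forall>f \<in> carrier (LWCQSym_bar k). \<forall>g \<in> carrier (LWCQSym_bar k).
        f \<otimes>\<^bsub>power_series k\<^esub> g \<in> carrier (LWCQSym_bar k)) \<and>
     (\<exists>!P. is_P_Q k P) \<and>
     rota_baxter_operator k (LWCQSym_bar k) (P_Q k) \<and>
     free_comm_rota_baxter_algebra TYPE('r) k (LWCQSym_bar k) (P_Q k) (M_bar k [1])"
proof -
  interpret cring k by fact
  have "rota_baxter_operator k (LWCQSym_bar k) (P_Q k)"
    by (rule comm_rota_baxter.rota_baxter_operator[OF comm_rota_baxter_P_Q])
  then show ?thesis
    using LWCQSym_bar_mult_closed free_LWCQSym_bar by (simp add: is_P_Q_iff)
qed

end
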